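(* Let $T\in\mathcal{A}_n[\mathbb{C}]$ with symbol $F_T(z,w)$. Then $T\in\mathcal{A}_n(\mathbb{C})$ (i.e. $T$ is stability preserving) if and only if the polynomial $F_T(z,-w)=F_T(z_1,\ldots,z_n,-w_1,\ldots,-w_n)$ belongs to $\mathcal{H}_{2n}(\mathbb{C})$ (i.e. is stable as a polynomial in the $2n$ variables $z_1,\ldots,z_n,w_1,\ldots,w_n$).
   Context: A polynomial $f\in\mathbb{C}[z_1,\ldots,z_n]$ is stable if $f(z_1,\ldots,z_n)\neq 0$ whenever $\operatorname{Im}(z_j)>0$ for all $1\le j\le n$. $\mathcal{H}_n(\mathbb{C})$ denotes the set of stable polynomials in $n$ variables. $\mathcal{A}_n[\mathbb{C}]$ is the Weyl algebra of finite order linear differential operators with polynomial coefficients on $\mathbb{C}[z_1,\ldots,z_n]$; each $T\in\mathcal{A}_n[\mathbb{C}]$ is uniquely a finite sum $T=\sum_{\alpha,\beta\in\mathbb{N}^n}a_{\alpha\beta}z^\alpha\partial^\beta$ with $a_{\alpha\beta}\in\mathbb{C}$ (where $\partial_i=\partial/\partial z_i$, multi-index notation), and its symbol is $F_T(z,w)=\sum_{\alpha,\beta}a_{\alpha\beta}z^\alpha w^\beta\in\mathbb{C}[z_1,\ldots,z_n,w_1,\ldots,w_n]$. A nonzero operator $T\in\mathcal{A}_n[\mathbb{C}]$ is stability preserving if $T(\mathcal{H}_n(\mathbb{C}))\subseteq\mathcal{H}_n(\mathbb{C})\cup\{0\}$; $\mathcal{A}_n(\mathbb{C})$ denotes the set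 of all stability preserving operators. *)

theory Defs
  imports Complex_Main "HOL-Library.Poly_Mapping"
begin

abbreviation lookup where "lookup \<equiv> Poly_Mapping.lookup"
abbreviation single where "single \<equiv> Poly_Mapping.single"
abbreviation keys where "keys \<equiv> Poly_Mapping.keys"

section \<open>Complex polynomials in finitely many variables\<close>

text \<open>
  The variables are indexed by a finite type \<open>'v\<close>; polynomials in \<open>n\<close> variables are those
  with \<open>CARD('v) = n\<close>. Polynomials are finitely supported maps from exponents to coefficients,
  and the ring structure is that of \<open>Poly_Mapping\<close>, whose multiplication is convolution.
\<close>

type_synonym 'v multi_index = "'v \<Rightarrow>\<^sub>0 nat"
type_synonym 'v mpoly = "'v multi_index \<Rightarrow>\<^sub>0 complex"

definition mconst :: "complex \<Rightarrow> 'v mpoly" where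
  "mconst c = single 0 c"

definition mvar :: "'v \<Rightarrow> 'v mpoly" where
  "mvar i = single (single i 1) 1"

definition mpow :: "('v::finite \<Rightarrow> 'a::comm_monoid_mult) \<Rightarrow> 'v multi_index \<Rightarrow> 'a" where
  "mpow x \<alpha> = (\<Prod>i\<in>UNIV. x i ^ lookup \<alpha> i)"

definition meval :: "'v::finite mpoly \<Rightarrow> ('v \<Rightarrow> complex) \<Rightarrow> complex" where
  "meval p x = (\<Sum>\<alpha>\<in>keys p. lookup p \<alpha> * mpow x \<alpha>)"

definition msubst :: "('v::finite \<Rightarrow> 'u mpoly) \<Rightarrow> 'v mpoly \<Rightarrow> 'u mpoly" where
  "msubst \<sigma> p = (\<Sum>\<alpha>\<in>keys p. mconst (lookup p \<alpha>) * mpow \<sigma> \<alpha>)"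

text \<open>The summand with \<open>lookup \<alpha> i = 0\<close> vanishes, so the truncated subtraction is harmless.\<close>

definition mpderiv :: "'v \<Rightarrow> 'v mpoly \<Rightarrow> 'v mpoly" where
  "mpderiv i p = (\<Sum>\<alpha>\<in>keys p. single (\<alpha> - single i 1) (of_nat (lookup \<alpha> i) * lookup p \<alpha>))"

text \<open>
  \<open>mpderivs \<beta>\<close> is the composition of the powers \<open>mpderiv i ^^ lookup \<beta> i\<close> over all \<open>i\<close>; the
  order does not matter, see \<open>comp_fun_commute_mpderiv\<close> below.
\<close>

definition mpderivs :: "'v::finite multi_index \<Rightarrow> 'v mpoly \<Rightarrow> 'v mpoly" where
  "mpderivs \<beta> p = Finite_Set.fold (\<lambda>i. mpderiv i ^^ lookup \<beta> i) p UNIV"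

definition stable :: "'v::finite mpoly \<Rightarrow> bool" where
  "stable p \<longleftrightarrow> (\<forall>x. (\<forall>i. Im (x i) > 0) \<longrightarrow> meval p x \<noteq> 0)"

definition stable_polys :: "'v::finite mpoly set" where
  "stable_polys = {p. stable p}"


section \<open>The Weyl algebra and symbols\<close>

text \<open>
  \<open>weyl_op a\<close> is the operator with coefficients \<open>a\<^bsub>\<alpha>\<beta>\<^esub> = lookup a (\<alpha>, \<beta>)\<close> of
  \<open>z\<^sup>\<alpha> \<partial>\<^sup>\<beta>\<close>.
\<close>

type_synonym 'v weyl_coeffs = "('v multi_index \<times> 'v multi_index) \<Rightarrow>\<^sub>0 complex"

definition weyl_op :: "'v::finite weyl_coeffs \<Rightarrow> 'v mpoly \<Rightarrow> 'v mpoly" where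
  "weyl_op a p = (\<Sum>(\<alpha>, \<beta>)\<in>keys a. mconst (lookup a (\<alpha>, \<beta>)) * mpow mvar \<alpha> * mpderivs \<beta> p)"

definition weyl_algebra :: "('v::finite mpoly \<Rightarrow> 'v mpoly) set" where
  "weyl_algebra = range weyl_op"

text \<open>The coefficients are unique by \<open>inj_weyl_op\<close> below.\<close>

definition weyl_coeffs :: "('v::finite mpoly \<Rightarrow> 'v mpoly) \<Rightarrow> 'v weyl_coeffs" where
  "weyl_coeffs T = (THE a. T = weyl_op a)"

text \<open>
  The \<open>2n\<close> variables of the symbol are indexed by \<open>'v + 'v\<close>: \<open>Inl i\<close> is \<open>z\<^sub>i\<close> and
  \<open>Inr i\<close> is \<open>w\<^sub>i\<close>.
\<close>

definition symbol :: "('v::finite mpoly \<Rightarrow> 'v mpoly) \<Rightarrow> ('v + 'v) mpoly" where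
  "symbol T = (let a = weyl_coeffs T in
     \<Sum>(\<alpha>, \<beta>)\<in>keys a. mconst (lookup a (\<alpha>, \<beta>)) *
        mpow (\<lambda>i. mvar (Inl i)) \<alpha> * mpow (\<lambda>i. mvar (Inr i)) \<beta>)"

text \<open>\<open>F(z, w)\<close> becomes \<open>F(z, -w)\<close>.\<close>

definition negate_w :: "('v::finite + 'v) mpoly \<Rightarrow> ('v + 'v) mpoly" where
  "negate_w F = msubst (case_sum (\<lambda>i. mvar (Inl i)) (\<lambda>i. - mvar (Inr i))) F"

definition stability_preservers :: "('v::finite mpoly \<Rightarrow> 'v mpoly) set" where
  "stability_preservers =
     {T \<in> weyl_algebra. T \<noteq> (\<lambda>p. 0) \<and> T ` stable_polys \<subseteq> stable_polys \<union> {0}}"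


section \<open>Well-definedness of iterated derivatives and of symbols\<close>

lemma lookup_mpderiv:
  "lookup (mpderiv i p) \<alpha> = of_nat (lookup \<alpha> i + 1) * lookup p (\<alpha> + single i 1)"
proof -
  have *: "lookup (single (\<gamma> - single i 1) (of_nat (lookup \<gamma> i) * lookup p \<gamma>)) \<alpha> =
      (if \<gamma> = \<alpha> + single i 1 then of_nat (lookup \<alpha> i + 1) * lookup p (\<alpha> + single i 1) else 0)" for \<gamma>
  proof (cases "lookup \<gamma> i = 0")
    case True
    then have "\<gamma> \<noteq> \<alpha> + single i 1" by (auto simp: lookup_add)
    with True show ?thesis by simp
  next
    case False
    then have "\<gamma> - single i 1 = \<alpha> \<longleftrightarrow> \<gamma> = \<alpha> + single i 1"
      by (auto simp: poly_mapping_eq_iff fun_eq_iff lookup_add lookup_minus lookup_single when_def)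
    then show ?thesis by (auto simp: lookup_single when_def lookup_add)
  qed
  show ?thesis
    unfolding mpderiv_def lookup_sum * by (simp add: in_keys_iff)
qed

lemma mpderiv_commute: "mpderiv i (mpderiv j p) = mpderiv j (mpderiv i p)"
  by (rule poly_mapping_eqI) (auto simp: lookup_mpderiv lookup_add lookup_single when_def ac_simps)

lemma comp_fun_commute_mpderiv: "comp_fun_commute (\<lambda>i. mpderiv i ^^ k i)"
proof
  fix i j :: 'a
  have 1: "(mpderiv i ^^ m) (mpderiv j p) = mpderiv j ((mpderiv i ^^ m) p)" for i j :: 'a and m p
    by (induction m) (auto simp: mpderiv_commute [of i j])
  have "(mpderiv j ^^ l) ((mpderiv i ^^ m) p) = (mpderiv i ^^ m) ((mpderiv j ^^ l) p)" for l m p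
    by (induction l) (auto simp: 1)
  then show "(mpderiv j ^^ k j) \<circ> (mpderiv i ^^ k i) = (mpderiv i ^^ k i) \<circ> (mpderiv j ^^ k j)"
    by (simp add: fun_eq_iff)
qed

lemma lookup_mpderiv_power:
  "lookup ((mpderiv i ^^ k) p) \<alpha> =
     pochhammer (of_nat (lookup \<alpha> i + 1)) k * lookup p (\<alpha> + single i k)"
proof (induction k arbitrary: \<alpha>)
  case (Suc k)
  have "single i (Suc 0) + single i k = single i (Suc k)"
    by (simp add: single_add [symmetric])
  with Suc show ?case
    by (simp add: lookup_mpderiv pochhammer_rec lookup_add add.assoc ac_simps)
qed simp

lemma lookup_mpderivs:
  "lookup (mpderivs \<beta> p) \<alpha> =
     (\<Prod>i\<in>UNIV. pochhammer (of_nat (lookup \<alpha> i + 1)) (lookup \<beta> i)) * lookup p (\<alpha> + \<beta>)"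
proof -
  interpret comp_fun_commute "\<lambda>i. mpderiv i ^^ lookup \<beta> i" by (rule comp_fun_commute_mpderiv)
  have "lookup (Finite_Set.fold (\<lambda>i. mpderiv i ^^ lookup \<beta> i) p A) \<alpha> =
     (\<Prod>i\<in>A. pochhammer (of_nat (lookup \<alpha> i + 1)) (lookup \<beta> i)) *
       lookup p (\<alpha> + (\<Sum>i\<in>A. single i (lookup \<beta> i)))" if "finite A" for A
    using that
  proof (induction A arbitrary: \<alpha>)
    case (insert j A)
    have "(\<Prod>i\<in>A. pochhammer (of_nat (lookup (\<alpha> + single j (lookup \<beta> j)) i + 1) :: complex) (lookup \<beta> i)) =
        (\<Prod>i\<in>A. pochhammer (of_nat (lookup \<alpha> i + 1)) (lookup \<beta> i))"
      by (rule prod.cong) (use insert in \<open>auto simp: lookup_add lookup_single when_def\<close>)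
    with insert show ?case
      by (simp add: lookup_mpderiv_power add.assoc)
  qed simp
  moreover have "(\<Sum>i\<in>UNIV. single i (lookup \<beta> i)) = \<beta>"
    by (rule poly_mapping_eqI) (simp add: lookup_sum lookup_single when_def)
  ultimately show ?thesis by (simp add: mpderivs_def)
qed

lemma mpow_mvar: "mpow mvar \<alpha> = single \<alpha> 1"
proof -
  have pow: "mvar i ^ k = single (single i k) 1" for i :: 'a and k
  proof (induction k)
    case (Suc k)
    have "single i (Suc 0) + single i k = single i (Suc k)"
      by (simp only: single_add [symmetric]) simp
    with Suc show ?case by (simp add: mvar_def mult_single)
  qed simp
  have "(\<Prod>i\<in>A. mvar i ^ lookup \<alpha> i) = single (\<Sum>i\<in>A. single i (lookup \<alpha> i)) 1"
    if "finite A" for A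
    using that by induction (auto simp: pow mult_single)
  moreover have "(\<Sum>i\<in>UNIV. single i (lookup \<alpha> i)) = \<alpha>"
    by (rule poly_mapping_eqI) (simp add: lookup_sum lookup_single when_def)
  ultimately show ?thesis by (simp add: mpow_def)
qed

lemma inj_weyl_op: "inj weyl_op"
proof (rule injI, rule ccontr)
  fix a b :: "'v::finite weyl_coeffs"
  assume eq: "weyl_op a = weyl_op b" and "a \<noteq> b"
  define size :: "'v multi_index \<Rightarrow> nat" where "size \<beta> = (\<Sum>i\<in>UNIV. lookup \<beta> i)" for \<beta>
  have size_add: "size (\<alpha> + \<beta>) = size \<alpha> + size \<beta>" for \<alpha> \<beta>
    by (simp add: size_def lookup_add sum.distrib)
  have size_0: "\<alpha> = 0" if "size \<alpha> = 0" for \<alpha>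
    using that by (intro poly_mapping_eqI) (simp add: size_def)
  let ?P = "\<lambda>\<gamma>. lookup a \<gamma> \<noteq> lookup b \<gamma>"
  from \<open>a \<noteq> b\<close> obtain \<gamma> where "?P \<gamma>" by (meson poly_mapping_eqI)
  then obtain \<gamma>0 where \<gamma>0: "?P \<gamma>0" and min: "\<And>\<gamma>. ?P \<gamma> \<Longrightarrow> size (snd \<gamma>0) \<le> size (snd \<gamma>)"
    using ex_has_least_nat [of ?P \<gamma> "\<lambda>\<gamma>. size (snd \<gamma>)"] by auto
  obtain \<alpha>0 \<beta>0 where \<gamma>0_eq: "\<gamma>0 = (\<alpha>0, \<beta>0)" by (cases \<gamma>0)
  define f :: "'v mpoly" where "f = single \<beta>0 1"
  define c :: complex where "c = (\<Prod>i\<in>UNIV. pochhammer 1 (lookup \<beta>0 i))"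
  have "c \<noteq> 0"
    unfolding c_def by (simp add: pochhammer_fact [symmetric])
  have deriv: "mpderivs \<beta> f = (if \<beta> = \<beta>0 then single 0 c else 0)" if "size \<beta>0 \<le> size \<beta>" for \<beta>
  proof (rule poly_mapping_eqI)
    fix \<alpha>
    have "\<alpha> + \<beta> = \<beta>0 \<longleftrightarrow> \<alpha> = 0 \<and> \<beta> = \<beta>0"
      using that size_add [of \<alpha> \<beta>] size_0 [of \<alpha>] by auto
    then show "lookup (mpderivs \<beta> f) \<alpha> = lookup (if \<beta> = \<beta>0 then single 0 c else 0) \<alpha>"
      by (auto simp: lookup_mpderivs f_def lookup_single when_def c_def)
  qed
  define t where "t a \<gamma> = mconst (lookup a \<gamma>) * mpow mvar (fst \<gamma>) * mpderivs (snd \<gamma>) f"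
    for a :: "'v weyl_coeffs" and \<gamma>
  define K where "K = keys a \<union> keys b"
  have [simp]: "finite K" by (simp add: K_def)
  have "weyl_op a f = sum (t a) (keys a)" "weyl_op b f = sum (t b) (keys b)"
    by (auto simp: weyl_op_def t_def intro!: sum.cong)
  moreover have "sum (t a) (keys a) = sum (t a) K" "sum (t b) (keys b) = sum (t b) K"
    by (rule sum.mono_neutral_left; auto simp: K_def t_def mconst_def in_keys_iff)+
  ultimately have "(\<Sum>\<gamma>\<in>K. t a \<gamma> - t b \<gamma>) = 0"
    using eq by (simp add: sum_subtractf)
  moreover have "t a \<gamma> - t b \<gamma> =
      (if snd \<gamma> = \<beta>0 then single (fst \<gamma>) ((lookup a \<gamma> - lookup b \<gamma>) * c) else 0)" for \<gamma>
  proof (cases "?P \<gamma>")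
    case True
    then show ?thesis
      using min [of \<gamma>] deriv [of "snd \<gamma>"] \<gamma>0_eq
      by (simp add: t_def mconst_def mpow_mvar mult_single left_diff_distrib single_diff)
  qed (simp add: t_def)
  ultimately have "(\<Sum>\<gamma>\<in>K. if snd \<gamma> = \<beta>0 then single (fst \<gamma>) ((lookup a \<gamma> - lookup b \<gamma>) * c) else 0) = 0"
    by simp
  then have "0 = lookup (\<Sum>\<gamma>\<in>K. if snd \<gamma> = \<beta>0 then single (fst \<gamma>) ((lookup a \<gamma> - lookup b \<gamma>) * c) else 0) \<alpha>0"
    by simp
  also have "\<dots> = (\<Sum>\<gamma>\<in>K. if \<gamma> = \<gamma>0 then (lookup a \<gamma>0 - lookup b \<gamma>0) * c else 0)"
    unfolding lookup_sum
    by (rule sum.cong) (auto simp: lookup_single when_def \<gamma>0_eq)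
  also have "\<dots> = (lookup a \<gamma>0 - lookup b \<gamma>0) * c"
    using \<gamma>0 by (auto simp: K_def in_keys_iff)
  finally show False
    using \<gamma>0 \<open>c \<noteq> 0\<close> by simp
qed

lemma weyl_coeffs_weyl_op [simp]: "weyl_coeffs (weyl_op a) = a"
  unfolding weyl_coeffs_def using inj_weyl_op by (auto dest: injD)

end

theory Submission
  imports Defs "HOL-Complex_Analysis.Great_Picard"
    "HOL-Computational_Algebra.Fundamental_Theorem_Algebra"
begin

text \<open>
  If \<open>F(z, -w)\<close> and \<open>f\<close> are stable, so is \<open>F(z, -w) f(v)\<close>. The operators \<open>1 - \<partial>\<^bsub>w\<^esub> \<partial>\<^bsub>v\<^esub> / m\<close>
  preserve stability by the Lieb--Sokal lemma; applying each of them \<open>m\<close> times and letting first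
  \<open>w \<rightarrow> 0\<close> and then \<open>m \<rightarrow> \<infinity>\<close> substitutes \<open>\<partial>\<^bsub>v\<^esub>\<close> for the second argument of \<open>F\<close>. By Hurwitz's
  theorem and \<open>v = z\<close>, \<open>T f\<close> is stable or zero.

  Conversely, \<open>f\<^sub>m(z) = \<Prod>\<^sub>i (1 - z\<^sub>i w\<^sub>i / m)\<^sup>m\<close> is stable for every \<open>w\<close> with positive imaginary
  parts and approximates \<open>exp (- z \<cdot> w)\<close>, and \<open>T (exp (- z \<cdot> w)) = F(z, -w) exp (- z \<cdot> w)\<close>. For
  large \<open>m\<close> the polynomial \<open>T f\<^sub>m\<close> cannot vanish identically: \<open>f\<^sub>m\<close> remains stable after a small
  perturbation by any polynomial of degree at most \<open>m\<close> in each variable, so otherwise \<open>T g\<close> would be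
  stable or zero for every such \<open>g\<close>, which forces \<open>T\<close> to have rank at most one. Hence \<open>T f\<^sub>m\<close>
  has no zeros in \<open>(z, w)\<close>, and Hurwitz's theorem applies in all \<open>2n\<close> variables.
\<close>

section \<open>Polynomial functions and their partial derivatives\<close>

text \<open>Polynomials are treated as functions, so that substitution, restriction to lines and
  Hurwitz's theorem apply directly. \<open>polyfun_meval\<close> and \<open>polyfun_eq_meval\<close>
  translate to and from \<open>mpoly\<close>.\<close>

inductive polyfun :: "(('u \<Rightarrow> complex) \<Rightarrow> complex) \<Rightarrow> bool" where
  const: "polyfun (\<lambda>x. c)"
| coord: "polyfun (\<lambda>x. x i)"
| add: "polyfun f \<Longrightarrow> polyfun g \<Longrightarrow> polyfun (\<lambda>x. f x + g x)"
| mult: "polyfun f \<Longrightarrow> polyfun g \<Longrightarrow> polyfun (\<lambda>x. f x * g x)"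

lemma polyfun_uminus: "polyfun f \<Longrightarrow> polyfun (\<lambda>x. - f x)"
  using polyfun.mult [OF polyfun.const [of "-1"], of f] by simp

lemma polyfun_diff: "polyfun f \<Longrightarrow> polyfun g \<Longrightarrow> polyfun (\<lambda>x. f x - g x)"
  using polyfun.add [OF _ polyfun_uminus, of f g] by simp

lemma polyfun_power: "polyfun f \<Longrightarrow> polyfun (\<lambda>x. f x ^ n)"
  by (induction n) (auto intro: polyfun.intros)

lemma polyfun_sum: "(\<And>k. k \<in> K \<Longrightarrow> polyfun (f k)) \<Longrightarrow> polyfun (\<lambda>x. \<Sum>k\<in>K. f k x)"
  by (induction K rule: infinite_finite_induct) (auto intro: polyfun.intros)

lemma polyfun_prod: "(\<And>k. k \<in> K \<Longrightarrow> polyfun (f k)) \<Longrightarrow> polyfun (\<lambda>x. \<Prod>k\<in>K. f k x)"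
  by (induction K rule: infinite_finite_induct) (auto intro: polyfun.intros)

lemma polyfun_poly: "polyfun f \<Longrightarrow> polyfun (\<lambda>x. poly q (f x))"
  unfolding poly_altdef by (intro polyfun_sum polyfun.mult polyfun.const polyfun_power)

lemma polyfun_subst:
  assumes "polyfun f" "\<And>i. polyfun (\<sigma> i)"
  shows "polyfun (\<lambda>x. f (\<lambda>i. \<sigma> i x))"
  using assms(1) by induction (auto intro: polyfun.intros assms)

lemma polyfun_mpow: "(\<And>i. polyfun (\<sigma> i)) \<Longrightarrow> polyfun (\<lambda>x. mpow (\<lambda>i. \<sigma> i x) \<alpha>)"
  unfolding mpow_def by (intro polyfun_prod polyfun_power)

lemma polyfun_meval: "polyfun (meval p)"
  unfolding meval_def [abs_def]
  by (intro polyfun_sum polyfun.mult polyfun.const polyfun_mpow polyfun.coord)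

lemma polyfun_holomorphic:
  assumes "polyfun f" "\<And>i. (\<lambda>t. x t i) holomorphic_on S"
  shows "(\<lambda>t. f (x t)) holomorphic_on S"
  using assms(1) by induction (auto intro!: holomorphic_intros assms)

lemma polyfun_continuous:
  assumes "polyfun f" "\<And>i. continuous_on S (\<lambda>t. x t i)"
  shows "continuous_on S (\<lambda>t. f (x t))"
  using assms(1) by induction (auto intro!: continuous_intros assms)

text \<open>Freezing all coordinates but one leaves a univariate polynomial. Through this, facts on
  roots and derivatives in one variable reach the multivariate setting.\<close>

lemma polyfun_restrict:
  assumes "polyfun f"
  obtains q where "\<And>t. f (x(i := t)) = poly q t"
proof -
  have "\<exists>q. \<forall>t. f (x(i := t)) = poly q t"
    using assms
  proof induction
    case (const c)
    show ?case by (rule exI [of _ "[:c:]"]) simp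
  next
    case (coord j)
    show ?case by (rule exI [of _ "if j = i then [:0, 1:] else [:x j:]"]) simp
  next
    case (add f g)
    then show ?case by (metis poly_add)
  next
    case (mult f g)
    then show ?case by (metis poly_mult)
  qed
  then show ?thesis using that by blast
qed

text \<open>Defined by \<open>deriv\<close> and therefore total; the sum and product rules assume
  \<open>polyfun\<close>, where each coordinate restriction is a genuine polynomial.\<close>

definition pd :: "'u \<Rightarrow> (('u \<Rightarrow> complex) \<Rightarrow> complex) \<Rightarrow> ('u \<Rightarrow> complex) \<Rightarrow> complex" where
  "pd i f x = deriv (\<lambda>t. f (x(i := t))) (x i)"

lemma pd_restrict:
  assumes "\<And>t. f (x(i := t)) = poly q t"
  shows "pd i f x = poly (pderiv q) (x i)"
  unfolding pd_def assms by (rule DERIV_imp_deriv) (rule poly_DERIV)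

lemma pd_const [simp]: "pd i (\<lambda>x. c) = (\<lambda>x. 0)"
  by (simp add: pd_def fun_eq_iff)

lemma pd_coord [simp]: "pd i (\<lambda>x. x j) = (\<lambda>x. if i = j then 1 else 0)"
  by (simp add: pd_def fun_eq_iff)

lemma pd_add:
  assumes "polyfun f" "polyfun g"
  shows "pd i (\<lambda>x. f x + g x) = (\<lambda>x. pd i f x + pd i g x)"
proof
  fix x
  obtain p where p: "\<And>t. f (x(i := t)) = poly p t" using polyfun_restrict [OF assms(1), of x i] by blast
  obtain q where q: "\<And>t. g (x(i := t)) = poly q t" using polyfun_restrict [OF assms(2), of x i] by blast
  show "pd i (\<lambda>x. f x + g x) x = pd i f x + pd i g x"
    using pd_restrict [of f, OF p] pd_restrict [of g, OF q]
      pd_restrict [of "\<lambda>x. f x + g x" x i "p + q"] p q by (simp add: pderiv_add)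
qed

lemma pd_mult:
  assumes "polyfun f" "polyfun g"
  shows "pd i (\<lambda>x. f x * g x) = (\<lambda>x. f x * pd i g x + pd i f x * g x)"
proof
  fix x
  obtain p where p: "\<And>t. f (x(i := t)) = poly p t" using polyfun_restrict [OF assms(1), of x i] by blast
  obtain q where q: "\<And>t. g (x(i := t)) = poly q t" using polyfun_restrict [OF assms(2), of x i] by blast
  have "f x = poly p (x i)" "g x = poly q (x i)"
    using p [of "x i"] q [of "x i"] by simp_all
  then show "pd i (\<lambda>x. f x * g x) x = f x * pd i g x + pd i f x * g x"
    using pd_restrict [of f, OF p] pd_restrict [of g, OF q]
      pd_restrict [of "\<lambda>x. f x * g x" x i "p * q"] p q by (simp add: pderiv_mult)
qed

lemma polyfun_pd: "polyfun f \<Longrightarrow> polyfun (pd i f)"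
  by (induction rule: polyfun.induct)
    (auto simp: pd_add pd_mult intro: polyfun.intros)

lemma polyfun_pd_power: "polyfun f \<Longrightarrow> polyfun ((pd i ^^ k) f)"
  by (induction k) (auto intro: polyfun_pd)

lemma pd_cmult: "polyfun f \<Longrightarrow> pd i (\<lambda>x. c * f x) = (\<lambda>x. c * pd i f x)"
  by (simp add: pd_mult polyfun.const)

lemma pd_sum:
  "(\<And>k. k \<in> K \<Longrightarrow> polyfun (f k)) \<Longrightarrow> pd i (\<lambda>x. \<Sum>k\<in>K. f k x) = (\<lambda>x. \<Sum>k\<in>K. pd i (f k) x)"
  by (induction K rule: infinite_finite_induct) (auto simp: pd_add polyfun_sum)

section \<open>Evaluation of polynomials and differential operators\<close>

lemma mpow_add: "mpow x (\<alpha> + \<beta>) = mpow x \<alpha> * mpow x \<beta>"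
  by (simp add: mpow_def lookup_add power_add prod.distrib)

lemma mpow_zero [simp]: "mpow x 0 = 1"
  by (simp add: mpow_def)

lemma meval_superset:
  assumes "finite K" "keys p \<subseteq> K"
  shows "meval p x = (\<Sum>\<alpha>\<in>K. lookup p \<alpha> * mpow x \<alpha>)"
  unfolding meval_def
  by (rule sum.mono_neutral_left) (use assms in \<open>auto simp: in_keys_iff\<close>)

lemma meval_zero [simp]: "meval 0 x = 0"
  by (simp add: meval_def)

lemma meval_single: "meval (single \<alpha> c) x = c * mpow x \<alpha>"
  by (simp add: meval_superset [of "{\<alpha>}"])

lemma meval_add: "meval (p + q) x = meval p x + meval q x"
  using meval_superset [of "keys p \<union> keys q" p] meval_superset [of "keys p \<union> keys q" q]
    meval_superset [of "keys p \<union> keys q" "p + q"] Poly_Mapping.keys_add [of p q]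
  by (simp add: lookup_add ring_distribs sum.distrib)

lemma meval_sum: "meval (\<Sum>k\<in>K. f k) x = (\<Sum>k\<in>K. meval (f k) x)"
  by (induction K rule: infinite_finite_induct) (auto simp: meval_add)

lemma mpoly_eq_sum: "p = (\<Sum>\<alpha>\<in>keys p. single \<alpha> (lookup p \<alpha>))"
  by (rule poly_mapping_eqI) (simp add: lookup_sum lookup_single when_def in_keys_iff)

lemma meval_mult: "meval (p * q) x = meval p x * meval q x"
proof -
  have "p * q = (\<Sum>\<alpha>\<in>keys p. \<Sum>\<beta>\<in>keys q. single (\<alpha> + \<beta>) (lookup p \<alpha> * lookup q \<beta>))"
    by (subst mpoly_eq_sum [of p], subst mpoly_eq_sum [of q]) (simp add: sum_product mult_single)
  then have "meval (p * q) x =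
      (\<Sum>\<alpha>\<in>keys p. \<Sum>\<beta>\<in>keys q. (lookup p \<alpha> * mpow x \<alpha>) * (lookup q \<beta> * mpow x \<beta>))"
    by (simp add: meval_sum meval_single mpow_add ac_simps)
  then show ?thesis
    by (simp add: meval_def sum_product)
qed

lemma meval_mconst [simp]: "meval (mconst c) x = c"
  by (simp add: mconst_def meval_single)

lemma meval_mvar [simp]: "meval (mvar i) x = x i"
proof -
  have "mpow x (single i 1) = (\<Prod>j\<in>UNIV. if j = i then x i else 1)"
    unfolding mpow_def by (rule prod.cong) (auto simp: lookup_single when_def)
  then show ?thesis by (simp add: mvar_def meval_single)
qed

lemma meval_one [simp]: "meval 1 x = 1"
  using meval_single [of 0 1 x] by simp

lemma meval_uminus: "meval (- p) x = - meval p x"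
  using meval_add [of p "- p" x] by (simp add: add_eq_0_iff)

lemma meval_power: "meval (p ^ n) x = meval p x ^ n"
  by (induction n) (auto simp: meval_mult)

lemma meval_prod: "meval (\<Prod>k\<in>K. f k) x = (\<Prod>k\<in>K. meval (f k) x)"
  by (induction K rule: infinite_finite_induct) (auto simp: meval_mult)

lemma meval_mpow: "meval (mpow \<sigma> \<alpha>) x = mpow (\<lambda>i. meval (\<sigma> i) x) \<alpha>"
  by (simp add: mpow_def meval_prod meval_power)

lemma meval_msubst: "meval (msubst \<sigma> p) x = meval p (\<lambda>i. meval (\<sigma> i) x)"
  by (simp add: msubst_def meval_sum meval_mult meval_mpow) (simp add: meval_def)

lemma polyfun_eq_meval:
  fixes f :: "('u::finite \<Rightarrow> complex) \<Rightarrow> complex"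
  assumes "polyfun f"
  obtains p where "meval p = f"
proof -
  have "\<exists>p. \<forall>x. meval p x = f x"
    using assms
  proof induction
    case (const c)
    show ?case by (rule exI [of _ "mconst c"]) simp
  next
    case (coord i)
    show ?case by (rule exI [of _ "mvar i"]) simp
  next
    case (add f g)
    then show ?case by (metis meval_add)
  next
    case (mult f g)
    then show ?case by (metis meval_mult)
  qed
  then show ?thesis using that by (auto simp: fun_eq_iff)
qed

section \<open>Analytic and formal derivatives agree\<close>

lemma pd_mpow: "pd i (\<lambda>x. mpow x \<alpha>) x = of_nat (lookup \<alpha> i) * mpow x (\<alpha> - single i 1)"
proof -
  define R where "R = (\<Prod>j\<in>UNIV - {i}. x j ^ lookup \<alpha> j)"
  have "(\<Prod>j\<in>UNIV - {i}. (x(i := t)) j ^ lookup \<alpha> j) = R" for t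
    unfolding R_def by (rule prod.cong) auto
  then have "mpow (x(i := t)) \<alpha> = poly (monom R (lookup \<alpha> i)) t" for t
    by (simp add: mpow_def prod.remove [of UNIV i] poly_monom)
  from pd_restrict [of "\<lambda>x. mpow x \<alpha>", OF this]
  have "pd i (\<lambda>x. mpow x \<alpha>) x = of_nat (lookup \<alpha> i) * (R * x i ^ (lookup \<alpha> i - 1))"
    by (simp add: pderiv_monom poly_monom)
  moreover have "mpow x (\<alpha> - single i 1) = x i ^ (lookup \<alpha> i - 1) * R"
    unfolding mpow_def R_def
    by (subst prod.remove [of UNIV i])
      (auto intro!: prod.cong simp: lookup_minus lookup_single when_def)
  ultimately show ?thesis by simp
qed

lemma meval_mpderiv: "meval (mpderiv i p) = pd i (meval p)"
proof
  fix x
  have "pd i (meval p) x = (\<Sum>\<alpha>\<in>keys p. lookup p \<alpha> * pd i (\<lambda>x. mpow x \<alpha>) x)"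
    unfolding meval_def [abs_def]
    by (simp add: pd_sum pd_cmult polyfun_mpow polyfun.coord polyfun.const polyfun.mult)
  then show "meval (mpderiv i p) x = pd i (meval p) x"
    by (simp add: mpderiv_def meval_sum meval_single pd_mpow ac_simps)
qed

lemma meval_mpderiv_power: "meval ((mpderiv i ^^ k) p) = (pd i ^^ k) (meval p)"
  by (induction k) (auto simp: meval_mpderiv)

text \<open>The derivatives are composed along a list so that they can be handled by list induction.
  For an enumeration of all variables this is \<open>mpderivs\<close>, by
  \<open>meval_mpderivs\<close>.\<close>

definition pds :: "'u list \<Rightarrow> ('u \<Rightarrow> nat) \<Rightarrow> (('u \<Rightarrow> complex) \<Rightarrow> complex) \<Rightarrow> ('u \<Rightarrow> complex) \<Rightarrow> complex" where
  "pds is b = fold (\<lambda>i. pd i ^^ b i) is"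

lemma meval_mpderivs:
  assumes "distinct is" "set is = UNIV"
  shows "meval (mpderivs \<beta> p) = pds is (lookup \<beta>) (meval p)"
proof -
  interpret comp_fun_commute "\<lambda>i. mpderiv i ^^ lookup \<beta> i"
    by (rule comp_fun_commute_mpderiv)
  have "meval (fold (\<lambda>i. mpderiv i ^^ lookup \<beta> i) js p) = pds js (lookup \<beta>) (meval p)" for js p
    by (induction js arbitrary: p) (auto simp: pds_def meval_mpderiv_power)
  then show ?thesis
    using fold_set_fold_remdups [where xs = "is" and y = p] assms
    by (simp add: mpderivs_def distinct_remdups_id)
qed

lemma polyfun_pds: "polyfun f \<Longrightarrow> polyfun (pds is b f)"
  by (induction "is" arbitrary: f) (auto simp: pds_def polyfun_pd_power)

lemma pd_power_add_cmult:
  assumes "polyfun f" "polyfun g"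
  shows "(pd i ^^ k) (\<lambda>x. f x + c * g x) = (\<lambda>x. (pd i ^^ k) f x + c * (pd i ^^ k) g x)"
  by (induction k) (simp_all add: pd_add pd_cmult polyfun.mult polyfun.const polyfun_pd_power assms)

lemma pds_add_cmult:
  assumes "polyfun f" "polyfun g"
  shows "pds is b (\<lambda>x. f x + c * g x) = (\<lambda>x. pds is b f x + c * pds is b g x)"
  using assms
  by (induction "is" arbitrary: f g) (simp_all add: pds_def pd_power_add_cmult polyfun_pd_power)

text \<open>On products of univariate polynomials in separate variables every mixed derivative
  factors. The test functions for the converse direction are of this form.\<close>

definition prodfun :: "('u::finite \<Rightarrow> complex poly) \<Rightarrow> ('u \<Rightarrow> complex) \<Rightarrow> complex" where
  "prodfun p x = (\<Prod>i\<in>UNIV. poly (p i) (x i))"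

lemma polyfun_prodfun: "polyfun (prodfun p)"
  unfolding prodfun_def [abs_def] by (intro polyfun_prod polyfun_poly polyfun.coord)

lemma pd_prodfun: "pd j (prodfun p) = prodfun (p(j := pderiv (p j)))"
proof
  fix x
  define R where "R = (\<Prod>i\<in>UNIV - {j}. poly (p i) (x i))"
  have "(\<Prod>i\<in>UNIV - {j}. poly (p i) ((x(j := t)) i)) = R" for t
    unfolding R_def by (rule prod.cong) auto
  then have "prodfun p (x(j := t)) = poly (smult R (p j)) t" for t
    by (simp add: prodfun_def prod.remove [of UNIV j])
  from pd_restrict [of "prodfun p", OF this]
  have "pd j (prodfun p) x = R * poly (pderiv (p j)) (x j)"
    by (simp add: pderiv_smult)
  also have "R = (\<Prod>i\<in>UNIV - {j}. poly ((p(j := pderiv (p j))) i) (x i))"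
    unfolding R_def by (rule prod.cong) auto
  finally show "pd j (prodfun p) x = prodfun (p(j := pderiv (p j))) x"
    by (simp add: prodfun_def [of "p(j := pderiv (p j))"] prod.remove [of UNIV j])
qed

lemma pd_power_prodfun: "(pd j ^^ k) (prodfun p) = prodfun (p(j := (pderiv ^^ k) (p j)))"
  by (induction k) (simp_all add: pd_prodfun fun_upd_def cong: if_cong)

lemma pds_prodfun:
  "distinct is \<Longrightarrow> pds is b (prodfun p) =
     prodfun (\<lambda>i. if i \<in> set is then (pderiv ^^ b i) (p i) else p i)"
proof (induction "is" arbitrary: p)
  case (Cons j js)
  then show ?case
    by (auto simp: pds_def pd_power_prodfun intro!: arg_cong [where f = prodfun])
qed (simp add: pds_def)

section \<open>Zeros in products of half-planes\<close>

definition uhp :: "('u \<Rightarrow> complex) set" where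
  "uhp = {x. \<forall>i. Im (x i) > 0}"

section \<open>Identity principle on products of half-planes\<close>

lemma infinite_upper_half_plane: "infinite {t. Im t > 0}"
proof -
  have "inj (\<lambda>n::nat. Complex 0 (real n + 1))"
    by (auto intro!: injI)
  moreover have "range (\<lambda>n::nat. Complex 0 (real n + 1)) \<subseteq> {t. Im t > 0}"
    by auto
  ultimately show ?thesis
    by (meson infinite_super range_inj_infinite)
qed

text \<open>The restriction to the i-th coordinate line has infinitely many roots, hence is the zero
  polynomial.\<close>

lemma pd_vanishes_uhp:
  assumes "polyfun f" "\<And>x. x \<in> uhp \<Longrightarrow> f x = 0" "x \<in> uhp"
  shows "pd i f x = 0"
proof -
  obtain q where q: "\<And>t. f (x(i := t)) = poly q t" using polyfun_restrict [OF assms(1), of x i] by blast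
  have "poly q t = 0" if "Im t > 0" for t
    using that assms(2) [of "x(i := t)"] assms(3) q by (auto simp: uhp_def)
  then have "{t. Im t > 0} \<subseteq> {t. poly q t = 0}" by auto
  then have "q = 0"
    using infinite_upper_half_plane poly_roots_finite infinite_super by blast
  then show ?thesis using pd_restrict [of f, OF q] by simp
qed

lemma pds_vanishes_uhp:
  assumes "polyfun f" "\<And>x. x \<in> uhp \<Longrightarrow> f x = 0" "x \<in> uhp"
  shows "pds is b f x = 0"
proof -
  have "\<forall>x\<in>uhp. (pd i ^^ k) f x = 0" if "polyfun f" "\<forall>x\<in>uhp. f x = 0" for i k and f :: "('a \<Rightarrow> complex) \<Rightarrow> complex"
    by (induction k) (use that in \<open>auto intro: pd_vanishes_uhp polyfun_pd_power\<close>)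
  then have "\<forall>x\<in>uhp. pds is b f x = 0"
    using assms(1,2)
    by (induction "is" arbitrary: f) (auto simp: pds_def polyfun_pd_power)
  with assms(3) show ?thesis by blast
qed

text \<open>If \<open>p\<close> vanished on \<open>uhp\<close>, so would all its derivatives; but
  differentiating by an exponent of maximal total degree leaves a nonzero constant.\<close>

lemma ex_nonzero_uhp:
  assumes "p \<noteq> 0"
  obtains x where "x \<in> uhp" "meval p x \<noteq> 0"
proof (rule ccontr)
  assume "\<not> thesis"
  with that have van: "\<And>x. x \<in> uhp \<Longrightarrow> meval p x = 0" by blast
  define size :: "'a multi_index \<Rightarrow> nat" where "size \<beta> = (\<Sum>i\<in>UNIV. lookup \<beta> i)" for \<beta>
  have size_0: "\<alpha> = 0" if "size \<alpha> = 0" for \<alpha>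
    using that by (intro poly_mapping_eqI) (simp add: size_def)
  have "keys p \<noteq> {}" using assms by simp
  then obtain \<beta> where \<beta>: "\<beta> \<in> keys p" "\<And>\<gamma>. \<gamma> \<in> keys p \<Longrightarrow> size \<gamma> \<le> size \<beta>"
    using obtains_MAX [of "keys p" size] Max_ge [of "size ` keys p"]
    by (metis finite_imageI finite_keys imageI)
  define c where "c = (\<Prod>i\<in>UNIV. pochhammer 1 (lookup \<beta> i)) * lookup p \<beta>"
  have "c \<noteq> 0"
    using \<beta>(1) by (simp add: c_def pochhammer_fact [symmetric] in_keys_iff)
  have "mpderivs \<beta> p = mconst c"
  proof (rule poly_mapping_eqI)
    fix \<alpha>
    have "\<alpha> + \<beta> \<notin> keys p" if "\<alpha> \<noteq> 0"
      using \<beta>(2) [of "\<alpha> + \<beta>"] size_0 [of \<alpha>] that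
      by (auto simp: size_def lookup_add sum.distrib)
    then show "lookup (mpderivs \<beta> p) \<alpha> = lookup (mconst c) \<alpha>"
      by (auto simp: lookup_mpderivs mconst_def lookup_single when_def c_def in_keys_iff)
  qed
  moreover obtain "is" :: "'a list" where "distinct is" "set is = UNIV"
    using finite_distinct_list [of "UNIV :: 'a set"] by auto
  moreover have "(\<lambda>_. \<i>) \<in> uhp" by (simp add: uhp_def)
  ultimately show False
    using meval_mpderivs [of "is" \<beta> p] pds_vanishes_uhp [OF polyfun_meval van, of "\<lambda>_. \<i>" "is" "lookup \<beta>"] \<open>c \<noteq> 0\<close>
    by (metis meval_mconst)
qed

text \<open>Joint continuity gives uniform convergence on compact sets as \<open>e = 1/m\<close>
  tends to 0, so Hurwitz's theorem applies to a limit that is not identically zero.\<close>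

lemma hurwitz_one_parameter:
  fixes G :: "real \<Rightarrow> complex \<Rightarrow> complex"
  assumes S: "open S" "connected S"
    and cont: "continuous_on UNIV (\<lambda>(e, t). G e t)"
    and hol: "\<And>e. G e holomorphic_on S"
    and nz: "\<And>m t. m \<ge> M \<Longrightarrow> t \<in> S \<Longrightarrow> G (1 / real m) t \<noteq> 0"
    and s: "s \<in> S" "G 0 s \<noteq> 0" and t: "t \<in> S"
  shows "G 0 t \<noteq> 0"
proof (cases "G 0 constant_on S")
  \<comment> \<open>Hurwitz's theorem is applied to nonconstant limits only; a constant limit has
    its nonzero value at \<open>s\<close> everywhere.\<close>
  case True
  then show ?thesis using s t by (metis constant_on_def)
next
  case False
  \<comment> \<open>The shift keeps the index at least \<open>M\<close> and the parameter inside the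
    compact interval from 0 to 1.\<close>
  define \<F> where "\<F> n = G (1 / real (Suc (n + M)))" for n
  have lim: "uniform_limit K \<F> (G 0) sequentially" if K: "compact K" for K
  proof (rule uniform_limitI)
    fix e :: real
    assume "e > 0"
    have "uniformly_continuous_on ({0..1} \<times> K) (\<lambda>(e, t). G e t)"
      using K by (intro compact_uniformly_continuous continuous_on_subset [OF cont] compact_Times) auto
    then obtain d where d: "d > 0" "\<And>a b. a \<in> {0..1} \<times> K \<Longrightarrow> b \<in> {0..1} \<times> K \<Longrightarrow> dist a b < d \<Longrightarrow>
        dist (case a of (e, t) \<Rightarrow> G e t) (case b of (e, t) \<Rightarrow> G e t) < e"
      using \<open>e > 0\<close> unfolding uniformly_continuous_on_def by (meson dist_commute)
    have "(\<lambda>n. 1 / real (Suc (n + M))) \<longlonglongrightarrow> 0"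
      using LIMSEQ_ignore_initial_segment [OF lim_inverse_n', of "Suc M"]
      by (simp add: inverse_eq_divide)
    then have "\<forall>\<^sub>F n in sequentially. 1 / real (Suc (n + M)) < d"
      using d(1) by (rule order_tendstoD)
    then show "\<forall>\<^sub>F n in sequentially. \<forall>t\<in>K. dist (\<F> n t) (G 0 t) < e"
    proof eventually_elim
      case (elim n)
      show ?case
      proof
        fix t
        assume "t \<in> K"
        with elim d(2) [of "(1 / real (Suc (n + M)), t)" "(0, t)"]
        show "dist (\<F> n t) (G 0 t) < e"
          by (simp add: \<F>_def dist_Pair_Pair del: of_nat_Suc)
      qed
    qed
  qed
  show ?thesis
    by (rule Hurwitz_no_zeros [of S \<F> "G 0"])
      (use S hol nz t lim False in \<open>auto simp: \<F>_def simp del: of_nat_Suc\<close>)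
qed

text \<open>Several variables reduce to one on the complex line through \<open>x\<close> and
  \<open>y\<close>: the parameters whose points lie in \<open>uhp\<close> form an open convex set
  containing 0 and 1.\<close>

lemma hurwitz_uhp:
  fixes G :: "real \<Rightarrow> ('u::finite \<Rightarrow> complex) \<Rightarrow> complex"
  assumes cont: "\<And>x y. continuous_on UNIV (\<lambda>(e, t). G e (\<lambda>i. x i + t * (y i - x i)))"
    and hol: "\<And>e. polyfun (G e)"
    and nz: "\<And>m x. m \<ge> M \<Longrightarrow> x \<in> uhp \<Longrightarrow> G (1 / real m) x \<noteq> 0"
    and y: "y \<in> uhp" "G 0 y \<noteq> 0" and x: "x \<in> uhp"
  shows "G 0 x \<noteq> 0"
proof -
  define l where "l t = (\<lambda>i. x i + t * (y i - x i))" for t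
  define S where "S = (\<Inter>i. (\<lambda>t. l t i) -` {z. Im z > 0})"
  have S_iff: "t \<in> S \<longleftrightarrow> l t \<in> uhp" for t
    by (auto simp: S_def uhp_def)
  have "open S"
    unfolding S_def l_def
    by (intro open_INT ballI continuous_open_vimage open_halfspace_Im_gt) (auto intro!: continuous_intros)
  moreover have "convex S"
    unfolding convex_def
  proof (intro ballI allI impI)
    fix s t and u v :: real
    assume st: "s \<in> S" "t \<in> S" and uv: "0 \<le> u" "0 \<le> v" "u + v = 1"
    have "l (u *\<^sub>R s + v *\<^sub>R t) i = u *\<^sub>R l s i + v *\<^sub>R l t i" for i
    proof -
      have "u *\<^sub>R l s i + v *\<^sub>R l t i = (u + v) *\<^sub>R x i + (u *\<^sub>R s + v *\<^sub>R t) * (y i - x i)"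
        by (simp add: l_def algebra_simps)
      then show ?thesis using uv by (simp add: l_def)
    qed
    moreover have "u * Im (l s i) + v * Im (l t i) > 0" for i
    proof (cases "u = 0")
      case True
      then show ?thesis using st uv by (auto simp: S_iff uhp_def)
    next
      case False
      then show ?thesis using st uv by (intro add_pos_nonneg) (auto simp: S_iff uhp_def less_imp_le)
    qed
    ultimately show "u *\<^sub>R s + v *\<^sub>R t \<in> S"
      by (auto simp: S_iff uhp_def)
  qed
  ultimately have S: "open S" "connected S" using convex_connected by blast+
  have "l 0 \<in> uhp" "l 1 \<in> uhp" "G 0 (l 1) \<noteq> 0"
    using x y by (simp_all add: l_def)
  moreover have "continuous_on UNIV (\<lambda>(e, t). G e (l t))"
    unfolding l_def by (rule cont)
  moreover have "(\<lambda>t. G e (l t)) holomorphic_on S" for e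
    unfolding l_def by (rule polyfun_holomorphic [OF hol]) (intro holomorphic_intros)
  ultimately have "G 0 (l 0) \<noteq> 0"
    using hurwitz_one_parameter [of S "\<lambda>e t. G e (l t)" M 1 0] S nz by (simp add: S_iff)
  then show ?thesis by (simp add: l_def)
qed

section \<open>The Lieb--Sokal lemma\<close>

lemma Im_inverse_diff_neg:
  assumes "Im t > 0" "Im \<xi> \<le> 0"
  shows "Im (1 / (t - \<xi>)) < 0"
proof -
  define w where "w = t - \<xi>"
  have w: "Im w > 0" using assms by (simp add: w_def)
  then have "(Re w)\<^sup>2 + (Im w)\<^sup>2 > 0"
    by (simp add: sum_power2_gt_zero_iff)
  with w have "- Im w / ((Re w)\<^sup>2 + (Im w)\<^sup>2) < 0"
    by (intro divide_neg_pos) auto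
  then have "Im (1 / w) < 0"
    by (simp add: Im_divide)
  then show ?thesis by (simp add: w_def)
qed

text \<open>The logarithmic derivative is the sum of \<open>1 / (t - \<xi>)\<close> over the roots
  \<xi>, counted with multiplicity. No root lies in the upper half-plane, so each summand has
  negative imaginary part; the induction splits off one root at a time.\<close>

lemma Im_log_deriv_nonpos:
  fixes q :: "complex poly"
  assumes "\<And>t. Im t > 0 \<Longrightarrow> poly q t \<noteq> 0" "Im t > 0"
  shows "Im (poly (pderiv q) t / poly q t) \<le> 0 \<and>
    (degree q > 0 \<longrightarrow> Im (poly (pderiv q) t / poly q t) < 0)"
  using assms
proof (induction "degree q" arbitrary: q)
  case 0
  then have "pderiv q = 0" by (simp add: pderiv_eq_0_iff)
  with 0 show ?case by simp
next
  case (Suc n)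
  then have "\<not> constant (poly q)"
    by (simp add: constant_degree)
  from Fundamental_Theorem_Algebra.fundamental_theorem_of_algebra [OF this] obtain \<xi> where root: "poly q \<xi> = 0" ..
  then have "[:- \<xi>, 1:] dvd q" by (simp add: poly_eq_0_iff_dvd)
  then obtain r where q: "q = [:- \<xi>, 1:] * r" ..
  with Suc.hyps(2) have "r \<noteq> 0" by auto
  then have "degree q = Suc (degree r)"
    unfolding q by (subst degree_mult_eq) auto
  with Suc.hyps(2) have deg: "n = degree r" by simp
  have \<xi>: "Im \<xi> \<le> 0"
    using Suc.prems(1) [of \<xi>] root by force
  have r: "poly r s \<noteq> 0" if "Im s > 0" for s
    using Suc.prems(1) [OF that] by (auto simp: q)
  have "t - \<xi> \<noteq> 0" using \<xi> Suc.prems(2) by auto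
  moreover have "poly (pderiv q) t = poly r t + (t - \<xi>) * poly (pderiv r) t"
    unfolding q pderiv_mult by (simp add: pderiv_pCons algebra_simps)
  ultimately have "poly (pderiv q) t / poly q t = 1 / (t - \<xi>) + poly (pderiv r) t / poly r t"
    using r [OF Suc.prems(2)] by (simp add: q field_simps)
  then show ?case
    using Suc.hyps(1) [OF deg r Suc.prems(2)] Im_inverse_diff_neg [OF Suc.prems(2) \<xi>] by simp
qed

text \<open>A zero would make the logarithmic derivative equal to \<open>- 1 / u\<close>, which has
  positive imaginary part.\<close>

lemma add_cmult_pderiv_nonzero:
  fixes q :: "complex poly"
  assumes "\<And>t. Im t > 0 \<Longrightarrow> poly q t \<noteq> 0" "Im t > 0" "Im u > 0"
  shows "poly q t + u * poly (pderiv q) t \<noteq> 0"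
proof
  assume *: "poly q t + u * poly (pderiv q) t = 0"
  have nz: "poly q t \<noteq> 0" "u \<noteq> 0" using assms by auto
  with * have "poly (pderiv q) t / poly q t = - (1 / u)"
    by (simp add: field_simps add_eq_0_iff2)
  then show False
    using Im_log_deriv_nonpos [of q t] assms Im_inverse_diff_neg [of u 0] by simp
qed

text \<open>The operator replaces \<open>u\<close> by \<open>-e d/dt\<close> in \<open>p + u q\<close>.\<close>

lemma lieb_sokal:
  fixes p q :: "complex poly"
  assumes nz: "\<And>t u. Im t > 0 \<Longrightarrow> Im u > 0 \<Longrightarrow> poly p t + u * poly q t \<noteq> 0"
    and p: "\<And>t. Im t > 0 \<Longrightarrow> poly p t \<noteq> 0"
    and e: "e \<ge> 0" and t: "Im t > 0"
  shows "poly p t - of_real e * poly (pderiv q) t \<noteq> 0"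
proof (cases "degree q = 0 \<or> e = 0")
  case True
  then show ?thesis
    using p [OF t] pderiv_eq_0_iff [of q] by auto
next
  case False
  define G where "G e s = poly q s - \<i> * of_real e * poly p s" for e s
  \<comment> \<open>Choosing \<open>u = \<i> m\<close> and rescaling shows that
    \<open>q - (\<i> / m) p\<close> has no zeros; Hurwitz's theorem carries this to
    \<open>q\<close>, which is not the zero polynomial.\<close>
  have q: "poly q s \<noteq> 0" if "Im s > 0" for s
  proof -
    have "finite {s. poly q s = 0}"
      using False by (intro poly_roots_finite) auto
    then have "\<not> {t. Im t > 0} \<subseteq> {s. poly q s = 0}"
      using infinite_upper_half_plane finite_subset by metis
    then obtain r where r: "Im r > 0" "poly q r \<noteq> 0"
      by auto
    have "G 0 s \<noteq> 0"
    proof (rule hurwitz_one_parameter [of "{t. Im t > 0}" G 1 r s])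
      show "open {t. Im t > 0}" by (rule open_halfspace_Im_gt)
      show "connected {t. Im t > 0}" by (intro convex_connected convex_halfspace_Im_gt)
      show "continuous_on UNIV (\<lambda>(e, t). G e t)"
        unfolding G_def case_prod_beta by (intro continuous_intros)
      show "G e holomorphic_on {t. Im t > 0}" for e
        unfolding G_def [abs_def] by (intro holomorphic_intros)
      show "G (1 / real m) t \<noteq> 0" if "m \<ge> 1" "t \<in> {t. Im t > 0}" for m t
      proof -
        have "G (1 / real m) t = (- \<i> / of_nat m) * (poly p t + (\<i> * of_nat m) * poly q t)"
          using that by (simp add: G_def field_simps)
        then show ?thesis
          using nz [of t "\<i> * of_nat m"] that by simp
      qed
    qed (use r that in \<open>auto simp: G_def\<close>)
    then show ?thesis by (simp add: G_def)
  qed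
  show ?thesis
  proof
    \<comment> \<open>Then \<open>p / q\<close> is \<open>e\<close> times the logarithmic derivative
      of \<open>q\<close> and has negative imaginary part. Hence \<open>u = - p / q\<close> is an
      admissible value at which \<open>p + u q\<close> vanishes.\<close>
    assume "poly p t - of_real e * poly (pderiv q) t = 0"
    then have "poly p t / poly q t = of_real e * (poly (pderiv q) t / poly q t)"
      by simp
    then have "Im (poly p t / poly q t) = Im (of_real e * (poly (pderiv q) t / poly q t))"
      by (simp only:)
    also have "\<dots> = e * Im (poly (pderiv q) t / poly q t)"
      by (simp only: Im_complex_of_real Re_complex_of_real times_complex.sel)
    also have "\<dots> < 0"
      using Im_log_deriv_nonpos [of q t] q t False e by (simp add: mult_pos_neg)
    finally have "Im (- (poly p t / poly q t)) > 0" by simp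
    from nz [OF t this] q [OF t] show False by simp
  qed
qed

text \<open>Applied \<open>m\<close> times with \<open>e = 1/m\<close>, this approximates \<open>exp (- \<partial>\<^sub>i \<partial>\<^sub>j)\<close>, which at \<open>x\<^sub>i = 0\<close>
  has the effect of substituting \<open>- \<partial>\<^sub>j\<close> for \<open>x\<^sub>i\<close>.\<close>

definition lieb_sokal_step :: "real \<Rightarrow> 'u \<Rightarrow> 'u \<Rightarrow> (('u \<Rightarrow> complex) \<Rightarrow> complex) \<Rightarrow> ('u \<Rightarrow> complex) \<Rightarrow> complex" where
  "lieb_sokal_step e i j f = (\<lambda>x. f x + (- of_real e) * pd i (pd j f) x)"

lemma polyfun_step: "polyfun f \<Longrightarrow> polyfun (lieb_sokal_step e i j f)"
  unfolding lieb_sokal_step_def by (intro polyfun.intros polyfun_pd)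

text \<open>Stability of \<open>f\<close> gives stability of \<open>f + u \<partial>\<^sub>j f\<close> in the variables of \<open>f\<close> and \<open>u\<close>; then \<open>u\<close> is replaced
  by \<open>- e \<partial>\<^sub>i\<close>.\<close>

lemma step_nonzero:
  assumes f: "polyfun f" and nz: "\<And>x. x \<in> uhp \<Longrightarrow> f x \<noteq> 0"
    and e: "e \<ge> 0" and x: "x \<in> uhp"
  shows "lieb_sokal_step e i j f x \<noteq> 0"
proof -
  obtain p where p: "\<And>t. f (x(i := t)) = poly p t"
    using polyfun_restrict [OF f, of x i] by blast
  obtain q where q: "\<And>t. pd j f (x(i := t)) = poly q t"
    using polyfun_restrict [OF polyfun_pd [OF f], of j x i] by blast
  have upd: "y(k := t) \<in> uhp" if "y \<in> uhp" "Im t > 0" for y :: "'a \<Rightarrow> complex" and k t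
    using that by (auto simp: uhp_def)
  have p_nz: "poly p t \<noteq> 0" if "Im t > 0" for t
    using nz [OF upd [OF x that, of i]] p [of t] by simp
  have "poly p t + u * poly q t \<noteq> 0" if t: "Im t > 0" and u: "Im u > 0" for t u
  proof -
    define y where "y = x(i := t)"
    have y: "y \<in> uhp" unfolding y_def by (rule upd [OF x t])
    obtain r where r: "\<And>s. f (y(j := s)) = poly r s"
      using polyfun_restrict [OF f, of y j] by blast
    have "poly r s \<noteq> 0" if "Im s > 0" for s
      using nz [OF upd [OF y that, of j]] r [of s] by simp
    then have "poly r (y j) + u * poly (pderiv r) (y j) \<noteq> 0"
      using y u by (intro add_cmult_pderiv_nonzero) (auto simp: uhp_def)
    moreover have "poly r (y j) = f y" using r [of "y j"] by simp
    ultimately show ?thesis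
      using pd_restrict [of f, OF r] p [of t] q [of t] by (simp add: y_def)
  qed
  from lieb_sokal [OF this p_nz e, of "x i"] x
  have "poly p (x i) - of_real e * poly (pderiv q) (x i) \<noteq> 0"
    by (auto simp: uhp_def)
  moreover have "f x = poly p (x i)" using p [of "x i"] by simp
  ultimately show ?thesis
    using pd_restrict [of "pd j f", OF q] by (simp add: lieb_sokal_step_def)
qed

section \<open>Operators with stable symbols\<close>

text \<open>For \<open>e = 1/m\<close> this is \<open>m (m - 1) ... (m - k + 1) / m^k\<close>. Being
  polynomial in \<open>e\<close>, it turns the limit of large \<open>m\<close> into continuity at
  \<open>e = 0\<close>.\<close>

definition falling_ratio :: "real \<Rightarrow> nat \<Rightarrow> complex" where
  "falling_ratio e k = (\<Prod>j<k. 1 - of_real e * of_nat j)"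

lemma falling_ratio_zero [simp]: "falling_ratio 0 k = 1"
  by (simp add: falling_ratio_def)

lemma prod_diff_eq_ff:
  assumes "m \<ge> 1"
  shows "(\<Prod>i<k. of_nat m - of_nat i) = of_nat m ^ k * falling_ratio (1 / real m) k"
proof -
  have "(\<Prod>i<k. of_nat m - of_nat i) = (\<Prod>i<k. of_nat m * (1 - of_real (1 / real m) * of_nat i :: complex))"
    using assms by (intro prod.cong) (auto simp: field_simps)
  then show ?thesis
    by (simp add: prod.distrib falling_ratio_def)
qed

lemma falling_ratio_binomial:
  assumes "m \<ge> 1"
  shows "of_real (1 / real m) ^ k * of_nat (fact k * (m choose k)) = falling_ratio (1 / real m) k"
proof -
  have "of_nat (fact k * (m choose k)) = (\<Prod>i<k. of_nat m - of_nat i :: complex)"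
    by (simp add: binomial_gbinomial gbinomial_prod_rev lessThan_atLeast0)
  then show ?thesis
    using assms by (simp add: prod_diff_eq_ff power_divide)
qed

lemma mpow_uminus: "mpow (\<lambda>i. - x i) \<alpha> = (\<Prod>i\<in>UNIV. (- 1) ^ lookup \<alpha> i) * mpow x \<alpha>"
  for x :: "'v::finite \<Rightarrow> complex"
  by (simp add: mpow_def prod.distrib [symmetric] power_mult_distrib [symmetric])

section \<open>Iterated steps: linearity and nonvanishing\<close>

lemma step_add_cmult:
  assumes "polyfun f" "polyfun g"
  shows "lieb_sokal_step e i j (\<lambda>x. f x + c * g x) = (\<lambda>x. lieb_sokal_step e i j f x + c * lieb_sokal_step e i j g x)"
  by (simp add: lieb_sokal_step_def pd_add pd_cmult polyfun_pd polyfun.mult polyfun.const assms algebra_simps)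

lemma polyfun_step_power: "polyfun f \<Longrightarrow> polyfun ((lieb_sokal_step e i j ^^ k) f)"
  by (induction k) (auto intro: polyfun_step)

lemma step_power_add_cmult:
  assumes "polyfun f" "polyfun g"
  shows "(lieb_sokal_step e i j ^^ k) (\<lambda>x. f x + c * g x) = (\<lambda>x. (lieb_sokal_step e i j ^^ k) f x + c * (lieb_sokal_step e i j ^^ k) g x)"
  by (induction k) (simp_all add: step_add_cmult polyfun_step_power assms)

lemma step_power_nonzero:
  assumes "polyfun f" "\<And>x. x \<in> uhp \<Longrightarrow> f x \<noteq> 0" "e \<ge> 0" "x \<in> uhp"
  shows "(lieb_sokal_step e i j ^^ k) f x \<noteq> 0"
  using assms(4)
proof (induction k arbitrary: x)
  case 0
  then show ?case using assms(2) by simp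
next
  case (Suc k)
  show ?case
    using step_nonzero [OF polyfun_step_power [OF assms(1)] Suc.IH assms(3) Suc.prems] by simp
qed

text \<open>\<open>Inl i\<close> is \<open>z\<^sub>i\<close>, \<open>Inr (Inl i)\<close> is \<open>w\<^sub>i\<close> and \<open>Inr (Inr i)\<close> is a copy \<open>v\<^sub>i\<close> of \<open>z\<^sub>i\<close> on which the
  operator acts.\<close>

type_synonym 'n zwv = "'n + 'n + 'n"

definition lieb_sokal_steps :: "real \<Rightarrow> nat \<Rightarrow> 'n list \<Rightarrow> (('n zwv \<Rightarrow> complex) \<Rightarrow> complex) \<Rightarrow> ('n zwv \<Rightarrow> complex) \<Rightarrow> complex" where
  "lieb_sokal_steps e m is = fold (\<lambda>i. lieb_sokal_step e (Inr (Inl i)) (Inr (Inr i)) ^^ m) is"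

lemma steps_Nil [simp]: "lieb_sokal_steps e m [] f = f"
  by (simp add: lieb_sokal_steps_def)

lemma steps_Cons [simp]:
  "lieb_sokal_steps e m (i # is) f = lieb_sokal_steps e m is ((lieb_sokal_step e (Inr (Inl i)) (Inr (Inr i)) ^^ m) f)"
  by (simp add: lieb_sokal_steps_def)

lemma polyfun_steps: "polyfun f \<Longrightarrow> polyfun (lieb_sokal_steps e m is f)"
  by (induction "is" arbitrary: f) (auto simp: polyfun_step_power)

lemma steps_add_cmult:
  assumes "polyfun f" "polyfun g"
  shows "lieb_sokal_steps e m is (\<lambda>x. f x + c * g x) = (\<lambda>x. lieb_sokal_steps e m is f x + c * lieb_sokal_steps e m is g x)"
  using assms
  by (induction "is" arbitrary: f g) (simp_all add: step_power_add_cmult polyfun_step_power)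

lemma steps_zero: "lieb_sokal_steps e m is (\<lambda>x. 0) = (\<lambda>x. 0)"
  using steps_add_cmult [of "\<lambda>x. 0" "\<lambda>x. 0" e m "is" "-1"] by (simp add: polyfun.const)

lemma steps_sum:
  "(\<And>k. k \<in> K \<Longrightarrow> polyfun (f k)) \<Longrightarrow>
     lieb_sokal_steps e m is (\<lambda>x. \<Sum>k\<in>K. f k x) = (\<lambda>x. \<Sum>k\<in>K. lieb_sokal_steps e m is (f k) x)"
proof (induction K rule: infinite_finite_induct)
  case (insert k K)
  then show ?case
    using steps_add_cmult [of "f k" "\<lambda>x. \<Sum>k\<in>K. f k x" e m "is" 1] by (simp add: polyfun_sum)
qed (simp_all add: steps_zero)

lemma steps_nonzero:
  assumes "polyfun f" "\<And>x. x \<in> uhp \<Longrightarrow> f x \<noteq> 0" "e \<ge> 0" "x \<in> uhp"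
  shows "lieb_sokal_steps e m is f x \<noteq> 0"
  using assms
proof (induction "is" arbitrary: f)
  case (Cons i "is")
  show ?case
    unfolding steps_Cons
    using Cons.prems by (intro Cons.IH polyfun_step_power step_power_nonzero)
qed simp

text \<open>A monomial in \<open>w\<close> with a coefficient in \<open>z\<close> and a function of
  \<open>v\<close>. One step maps such a term to a combination of two of them, so the effect of many
  steps can be computed exactly.\<close>

definition mterm :: "(('n::finite \<Rightarrow> complex) \<Rightarrow> complex) \<Rightarrow> ('n \<Rightarrow> nat) \<Rightarrow> (('n \<Rightarrow> complex) \<Rightarrow> complex) \<Rightarrow>
    ('n zwv \<Rightarrow> complex) \<Rightarrow> complex" where
  "mterm C b g x = C (\<lambda>i. x (Inl i)) * (\<Prod>i\<in>UNIV. x (Inr (Inl i)) ^ b i) * g (\<lambda>i. x (Inr (Inr i)))"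

lemma polyfun_mterm: "polyfun C \<Longrightarrow> polyfun g \<Longrightarrow> polyfun (mterm C b g)"
  unfolding mterm_def [abs_def]
  by (intro polyfun.mult polyfun_prod polyfun_power polyfun.coord)
    (rule polyfun_subst, assumption, rule polyfun.coord)+

lemma pd_v_mterm:
  assumes "polyfun g"
  shows "pd (Inr (Inr j)) (mterm C b g) = mterm C b (pd j g)"
proof
  fix x :: "'a zwv \<Rightarrow> complex"
  define v where "v = (\<lambda>i. x (Inr (Inr i)))"
  define R where "R = C (\<lambda>i. x (Inl i)) * (\<Prod>i\<in>UNIV. x (Inr (Inl i)) ^ b i)"
  obtain q where q: "\<And>t. g (v(j := t)) = poly q t"
    using polyfun_restrict [OF assms, of v j] by blast
  have "mterm C b g (x(Inr (Inr j) := t)) = poly (smult R q) t" for t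
  proof -
    have "(\<lambda>i. (x(Inr (Inr j) := t)) (Inr (Inr i))) = v(j := t)"
      by (auto simp: v_def)
    with q [of t] show ?thesis by (simp add: mterm_def R_def)
  qed
  from pd_restrict [of "mterm C b g", OF this] pd_restrict [of g, OF q]
  show "pd (Inr (Inr j)) (mterm C b g) x = mterm C b (pd j g) x"
    by (simp add: pderiv_smult mterm_def R_def v_def)
qed

lemma pd_w_mterm:
  "pd (Inr (Inl j)) (mterm C b g) = (\<lambda>x. of_nat (b j) * mterm C (b(j := b j - 1)) g x)"
proof
  fix x :: "'a zwv \<Rightarrow> complex"
  define P where "P = (\<Prod>i\<in>UNIV - {j}. x (Inr (Inl i)) ^ b i)"
  define R where "R = C (\<lambda>i. x (Inl i)) * P * g (\<lambda>i. x (Inr (Inr i)))"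
  have "(\<Prod>i\<in>UNIV - {j}. (x(Inr (Inl j) := t)) (Inr (Inl i)) ^ b i) = P" for t
    unfolding P_def by (rule prod.cong) auto
  then have "mterm C b g (x(Inr (Inl j) := t)) = poly (monom R (b j)) t" for t
    by (simp add: mterm_def R_def prod.remove [of UNIV j] poly_monom)
  from pd_restrict [of "mterm C b g", OF this]
  have 1: "pd (Inr (Inl j)) (mterm C b g) x = of_nat (b j) * (R * x (Inr (Inl j)) ^ (b j - 1))"
    by (simp add: pderiv_monom poly_monom)
  have "(\<Prod>i\<in>UNIV - {j}. x (Inr (Inl i)) ^ (b(j := b j - 1)) i) = P"
    unfolding P_def by (rule prod.cong) auto
  then have "mterm C (b(j := b j - 1)) g x = R * x (Inr (Inl j)) ^ (b j - 1)"
    by (simp add: mterm_def R_def prod.remove [of UNIV j])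
  with 1 show "pd (Inr (Inl j)) (mterm C b g) x = of_nat (b j) * mterm C (b(j := b j - 1)) g x"
    by simp
qed

lemma step_mterm:
  assumes "polyfun g"
  shows "lieb_sokal_step e (Inr (Inl j)) (Inr (Inr j)) (mterm C b g) =
    (\<lambda>x. mterm C b g x + (- of_real e * of_nat (b j)) * mterm C (b(j := b j - 1)) (pd j g) x)"
  by (simp add: lieb_sokal_step_def pd_v_mterm [OF assms] pd_w_mterm mult.assoc)

text \<open>The coefficient of \<open>\<partial>_v^k g\<close> in
  \<open>(1 - e \<partial>_w \<partial>_v)^m (w^k g(v))\<close> at \<open>w = 0\<close>.\<close>

definition step_weight :: "real \<Rightarrow> nat \<Rightarrow> nat \<Rightarrow> complex" where
  "step_weight e m k = (- of_real e) ^ k * of_nat (fact k * (m choose k))"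

lemma step_weight_0: "step_weight e 0 k = (if k = 0 then 1 else 0)"
  by (simp add: step_weight_def)

text \<open>Pascal's rule multiplied by \<open>(-e)^k k!\<close>. For \<open>k = 0\<close> the
  second summand is zero, whatever \<open>k - 1\<close> means.\<close>

lemma step_weight_Suc: "step_weight e (Suc m) k = step_weight e m k + (- of_real e * of_nat k) * step_weight e m (k - 1)"
  by (cases k) (simp_all add: step_weight_def algebra_simps)

lemma pds_cong: "(\<And>i. i \<in> set is \<Longrightarrow> b i = c i) \<Longrightarrow> pds is b f = pds is c f"
  unfolding pds_def by (intro fold_cong) auto

text \<open>At \<open>w_i = 0\<close> the only surviving term of the binomial expansion in the i-th
  pair differentiates as often as the exponent of \<open>w_i\<close> says. Variables outside the
  list keep their powers, which makes list induction possible.\<close>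

lemma steps_mterm:
  assumes "distinct is" "polyfun C" "polyfun g" "\<And>i. i \<in> set is \<Longrightarrow> x (Inr (Inl i)) = 0"
  shows "lieb_sokal_steps e m is (mterm C b g) x =
    C (\<lambda>i. x (Inl i)) * (\<Prod>i\<in>UNIV - set is. x (Inr (Inl i)) ^ b i) *
    (\<Prod>i\<in>set is. step_weight e m (b i)) * pds is b g (\<lambda>i. x (Inr (Inr i)))"
  using assms(1,3,4)
proof (induction "is" arbitrary: b g)
  case Nil
  then show ?case by (simp add: mterm_def pds_def)
next
  case (Cons j js)
  have j: "j \<notin> set js" "distinct js" using Cons.prems by auto
  have js: "x (Inr (Inl i)) = 0" if "i \<in> set js" for i using Cons.prems that by auto
  define R where "R b = C (\<lambda>i. x (Inl i)) * (\<Prod>i\<in>UNIV - set (j # js). x (Inr (Inl i)) ^ b i) *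
    (\<Prod>i\<in>set js. step_weight e m (b i))" for b
  have R_upd: "R (b(j := k)) = R b" for b k
    unfolding R_def using j by (intro arg_cong2 [where f = "(*)"] prod.cong refl) auto
  \<comment> \<open>The number of steps in the pair \<open>j\<close> is varied separately from
    \<open>m\<close>, with \<open>b\<close> and \<open>g\<close> arbitrary, since a single step
    lowers the exponent of \<open>w_j\<close> and differentiates \<open>g\<close>.\<close>
  have "lieb_sokal_steps e m js ((lieb_sokal_step e (Inr (Inl j)) (Inr (Inr j)) ^^ k) (mterm C b g)) x =
     R b * step_weight e k (b j) * pds js b ((pd j ^^ b j) g) (\<lambda>i. x (Inr (Inr i)))"
    if "polyfun g" for k b g
    using that
  proof (induction k arbitrary: b g)
    case 0
    have "UNIV - set js = insert j (UNIV - set (j # js))" using j by auto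
    then have "(\<Prod>i\<in>UNIV - set js. x (Inr (Inl i)) ^ b i) =
        x (Inr (Inl j)) ^ b j * (\<Prod>i\<in>UNIV - set (j # js). x (Inr (Inl i)) ^ b i)"
      by simp
    then show ?case
      using Cons.IH [OF j(2) 0 js, of b] Cons.prems(3) [of j] by (simp add: step_weight_0 R_def)
  next
    case (Suc k)
    define b' where "b' = b(j := b j - 1)"
    have pds_b': "pds js b' f = pds js b f" for f
      by (rule pds_cong) (use j in \<open>auto simp: b'_def\<close>)
    have poly: "polyfun ((lieb_sokal_step e i l ^^ k) (mterm C b g))" "polyfun ((lieb_sokal_step e i l ^^ k) (mterm C b' (pd j g)))"
      "polyfun (mterm C b g)" "polyfun (mterm C b' (pd j g))" for i l
      using Suc.prems assms(2) by (auto intro: polyfun_step_power polyfun_mterm polyfun_pd)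
    have pd: "(pd j ^^ (b j - 1)) (pd j g) = (pd j ^^ b j) g" if "b j \<noteq> 0"
      using that by (cases "b j") (simp_all add: funpow_swap1)
    have "lieb_sokal_steps e m js ((lieb_sokal_step e (Inr (Inl j)) (Inr (Inr j)) ^^ Suc k) (mterm C b g)) x =
      lieb_sokal_steps e m js ((lieb_sokal_step e (Inr (Inl j)) (Inr (Inr j)) ^^ k) (mterm C b g)) x +
      (- of_real e * of_nat (b j)) * lieb_sokal_steps e m js ((lieb_sokal_step e (Inr (Inl j)) (Inr (Inr j)) ^^ k) (mterm C b' (pd j g))) x"
      by (simp only: funpow_Suc_right o_apply step_mterm [OF Suc.prems] b'_def [symmetric]
          step_power_add_cmult [OF poly(3,4)] steps_add_cmult [OF poly(1,2)])
    also have "\<dots> = R b * step_weight e (Suc k) (b j) * pds js b ((pd j ^^ b j) g) (\<lambda>i. x (Inr (Inr i)))"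
      unfolding Suc.IH [OF Suc.prems] Suc.IH [OF polyfun_pd [OF Suc.prems]] pds_b'
      using pd by (cases "b j = 0") (simp_all add: step_weight_Suc b'_def R_upd algebra_simps)
    finally show ?case .
  qed
  from this [OF Cons.prems(2), of m b] show ?case
    using j by (simp add: R_def pds_def)
qed

text \<open>\<open>G 0\<close> is \<open>T f\<close>, and \<open>G (1/m)\<close> is the value at
  \<open>w = 0\<close>, \<open>v = z\<close> of \<open>S(z, -w) f(v)\<close> after \<open>m\<close>
  steps in each pair. Nonvanishing survives both limits by Hurwitz's theorem; the point
  \<open>y\<close> rules out a limit that is identically zero.\<close>

lemma symbol_nonzero_imp_op_nonzero:
  fixes a :: "'n::finite weyl_coeffs" and f :: "('n \<Rightarrow> complex) \<Rightarrow> complex" and "is" :: "'n list"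
  defines "S \<equiv> \<lambda>z w. \<Sum>\<gamma>\<in>keys a. lookup a \<gamma> * mpow z (fst \<gamma>) * mpow w (snd \<gamma>)"
  defines "G \<equiv> \<lambda>e z. \<Sum>\<gamma>\<in>keys a. lookup a \<gamma> * mpow z (fst \<gamma>) *
    (\<Prod>i\<in>UNIV. falling_ratio e (lookup (snd \<gamma>) i)) * pds is (lookup (snd \<gamma>)) f z"
  assumes dist: "distinct is" "set is = UNIV"
    and S: "\<And>z w. z \<in> uhp \<Longrightarrow> w \<in> uhp \<Longrightarrow> S z (\<lambda>i. - w i) \<noteq> 0"
    and f: "polyfun f" "\<And>z. z \<in> uhp \<Longrightarrow> f z \<noteq> 0"
    and y: "y \<in> uhp" "G 0 y \<noteq> 0" and x: "x \<in> uhp"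
  shows "G 0 x \<noteq> 0"
proof -
  \<comment> \<open>The sign of \<open>(-w)^\<beta>\<close> is moved into the coefficient; it later
    cancels the sign in \<open>step_weight\<close>.\<close>
  define C where "C \<gamma> z = lookup a \<gamma> * mpow z (fst \<gamma>) * (\<Prod>i\<in>UNIV. (- 1) ^ lookup (snd \<gamma>) i)"
    for \<gamma> and z :: "'n \<Rightarrow> complex"
  have C: "polyfun (C \<gamma>)" for \<gamma>
    unfolding C_def [abs_def] by (intro polyfun.intros polyfun_mpow)
  define \<Phi> where "\<Phi> x = (\<Sum>\<gamma>\<in>keys a. mterm (C \<gamma>) (lookup (snd \<gamma>)) f x)" for x
  have \<Phi>: "polyfun \<Phi>"
    unfolding \<Phi>_def [abs_def] by (intro polyfun_sum polyfun_mterm C f)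
  have "\<Phi> x = S (\<lambda>i. x (Inl i)) (\<lambda>i. - x (Inr (Inl i))) * f (\<lambda>i. x (Inr (Inr i)))" for x
  proof -
    show ?thesis
      by (simp add: \<Phi>_def S_def mterm_def C_def mpow_uminus mpow_def [of "\<lambda>i. x (Inr (Inl i))"] sum_distrib_left sum_distrib_right ac_simps)
  qed
  then have \<Phi>_nz: "\<Phi> x \<noteq> 0" if "x \<in> uhp" for x
    using that S f(2) by (auto simp: uhp_def)
  have zwv_cases: thesis if "\<And>j. i = Inl j \<Longrightarrow> thesis" "\<And>j. i = Inr (Inl j) \<Longrightarrow> thesis"
    "\<And>j. i = Inr (Inr j) \<Longrightarrow> thesis" for i :: "'n zwv" and thesis
    using that by (metis sum.exhaust)
  \<comment> \<open>The copy \<open>v\<close> is identified with \<open>z\<close>, and every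
    \<open>w_i\<close> is \<open>\<i> e\<close>: for \<open>e > 0\<close> the point stays in
    \<open>uhp\<close>, and \<open>e = 0\<close> is the limit \<open>w = 0\<close>.\<close>
  define emb :: "real \<Rightarrow> ('n \<Rightarrow> complex) \<Rightarrow> 'n zwv \<Rightarrow> complex" where
    "emb e z = case_sum z (case_sum (\<lambda>_. \<i> * of_real e) z)" for e :: real and z :: "'n \<Rightarrow> complex"
  have steps_\<Phi>: "lieb_sokal_steps (1 / real m) m is \<Phi> (emb 0 z) = G (1 / real m) z" if "m \<ge> 1" for m z
  proof -
    have "step_weight (1 / real m) m k = (- 1) ^ k * falling_ratio (1 / real m) k" for k
      using falling_ratio_binomial [OF that, of k] power_minus [of "of_real (1 / real m) :: complex" k]
      by (simp add: step_weight_def)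
    then have "(\<Prod>i\<in>UNIV. (- 1) ^ lookup \<beta> i) * (\<Prod>i\<in>UNIV. step_weight (1 / real m) m (lookup \<beta> i)) =
        (\<Prod>i\<in>UNIV. falling_ratio (1 / real m) (lookup \<beta> i))" for \<beta> :: "'n multi_index"
      by (simp add: prod.distrib [symmetric] power_mult_distrib [symmetric] mult.assoc [symmetric])
    moreover have "lieb_sokal_steps (1 / real m) m is (mterm (C \<gamma>) (lookup (snd \<gamma>)) f) (emb 0 z) =
        C \<gamma> z * (\<Prod>i\<in>UNIV. step_weight (1 / real m) m (lookup (snd \<gamma>) i)) * pds is (lookup (snd \<gamma>)) f z" for \<gamma>
      by (subst steps_mterm [OF dist(1) C f(1)]) (simp_all add: dist emb_def)
    ultimately show ?thesis
      unfolding \<Phi>_def [abs_def]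
      by (subst steps_sum) (auto simp: G_def C_def mult.assoc intro!: polyfun_mterm C f sum.cong)
  qed
  have G_poly: "polyfun (G e)" for e
    unfolding G_def by (intro polyfun_sum polyfun.mult polyfun.const polyfun_mpow polyfun.coord polyfun_pds f)
  have G_cont: "continuous_on UNIV (\<lambda>(e, t). G e (\<lambda>i. x i + t * (y i - x i)))" for x y :: "'n \<Rightarrow> complex"
  proof -
    have "continuous_on UNIV (\<lambda>p. \<Prod>i\<in>UNIV. falling_ratio (fst p) (lookup \<beta> i))" for \<beta> :: "'n multi_index"
      unfolding falling_ratio_def by (intro continuous_intros)
    moreover have line: "continuous_on UNIV (\<lambda>p. h (\<lambda>i. x i + snd p * (y i - x i)))"
      if "polyfun h" for h :: "('n \<Rightarrow> complex) \<Rightarrow> complex"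
      by (rule polyfun_continuous [OF that]) (intro continuous_intros)
    ultimately show ?thesis
      unfolding G_def case_prod_beta
      by (intro continuous_on_sum continuous_on_mult continuous_on_const line polyfun_pds f
          line [OF polyfun_mpow [of "\<lambda>i z. z i", OF polyfun.coord]])
  qed
  \<comment> \<open>First limit: \<open>m\<close> is fixed and \<open>w\<close> tends to 0. A
    nonzero value at \<open>y\<close> is assumed here; it holds for all large \<open>m\<close>
    because \<open>G (1/m) y\<close> converges to \<open>G 0 y\<close>.\<close>
  have step_nz: "G (1 / real m) z \<noteq> 0" if m: "m \<ge> 1" and nz: "G (1 / real m) y \<noteq> 0" and z: "z \<in> uhp" for m z
  proof -
    define H where "H e z = lieb_sokal_steps (1 / real m) m is \<Phi> (emb e z)" for e z
    have "H 0 z \<noteq> 0"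
    proof (rule hurwitz_uhp [where G = H and M = 1])
      show "continuous_on UNIV (\<lambda>(e, t). H e (\<lambda>i. x i + t * (y i - x i)))" for x y
        unfolding H_def case_prod_beta
      proof (rule polyfun_continuous [OF polyfun_steps [OF \<Phi>]])
        fix i :: "'n zwv"
        show "continuous_on UNIV (\<lambda>p. emb (fst p) (\<lambda>i. x i + snd p * (y i - x i)) i)"
          by (rule zwv_cases [of i]) (simp_all add: emb_def, (intro continuous_intros)+)
      qed
      show "polyfun (H e)" for e
        unfolding H_def
      proof (rule polyfun_subst [OF polyfun_steps [OF \<Phi>]])
        show "polyfun (\<lambda>z. emb e z i)" for i :: "'n zwv"
          by (rule zwv_cases [of i]) (simp_all add: emb_def polyfun.const polyfun.coord)
      qed
      show "H (1 / real k) z \<noteq> 0" if "1 \<le> k" "z \<in> uhp" for k z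
        unfolding H_def
        by (rule steps_nonzero [OF \<Phi> \<Phi>_nz])
          (use that in \<open>auto simp: uhp_def emb_def split: sum.split\<close>)
    qed (use steps_\<Phi> [OF m] nz y z in \<open>auto simp: H_def\<close>)
    then show ?thesis using steps_\<Phi> [OF m] by (simp add: H_def)
  qed
  have "(\<lambda>m. G (1 / real m) y) \<longlonglongrightarrow> G 0 y"
  proof -
    have "continuous_on UNIV (\<lambda>e. G e y)"
      using continuous_on_compose2 [OF G_cont [of y y], of UNIV "\<lambda>e. (e, 0)"]
      by (simp add: continuous_on_Pair continuous_on_id)
    then have "isCont (\<lambda>e. G e y) 0"
      by (simp add: continuous_on_eq_continuous_at)
    then show ?thesis
      using isCont_tendsto_compose [OF _ lim_1_over_n] by blast
  qed
  then have "\<forall>\<^sub>F m in sequentially. G (1 / real m) y \<noteq> 0"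
    using y(2) by (rule tendsto_imp_eventually_ne)
  then obtain M where M: "\<And>m. m \<ge> M \<Longrightarrow> G (1 / real m) y \<noteq> 0"
    by (auto simp: eventually_sequentially)
  \<comment> \<open>Second limit: \<open>m\<close> tends to infinity.\<close>
  show ?thesis
    by (rule hurwitz_uhp [where G = G and M = "max M 1", OF G_cont G_poly _ y x])
      (use step_nz M in auto)
qed

section \<open>Symbols of stability preservers\<close>

definition opfun :: "'n::finite weyl_coeffs \<Rightarrow> 'n list \<Rightarrow> (('n \<Rightarrow> complex) \<Rightarrow> complex) \<Rightarrow> ('n \<Rightarrow> complex) \<Rightarrow> complex" where
  "opfun a is f z = (\<Sum>\<gamma>\<in>keys a. lookup a \<gamma> * mpow z (fst \<gamma>) * pds is (lookup (snd \<gamma>)) f z)"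

lemma meval_weyl_op:
  assumes "distinct is" "set is = UNIV"
  shows "meval (weyl_op a p) z = opfun a is (meval p) z"
  by (simp add: weyl_op_def opfun_def meval_sum case_prod_beta meval_mult meval_mpow meval_mpderivs [OF assms])

lemma opfun_add_cmult:
  "polyfun f \<Longrightarrow> polyfun g \<Longrightarrow> opfun a is (\<lambda>x. f x + c * g x) z = opfun a is f z + c * opfun a is g z"
  by (simp add: opfun_def pds_add_cmult algebra_simps sum.distrib sum_distrib_left)

lemma meval_negate_symbol:
  "meval (negate_w (symbol (weyl_op a))) x =
     (\<Sum>\<gamma>\<in>keys a. lookup a \<gamma> * mpow (\<lambda>i. x (Inl i)) (fst \<gamma>) * mpow (\<lambda>i. - x (Inr i)) (snd \<gamma>))"
  by (simp add: negate_w_def meval_msubst symbol_def meval_sum case_prod_beta meval_mult meval_mpow meval_uminus)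

text \<open>The polynomial coefficient of \<open>\<partial>^\<beta>\<close> when the operator is
  ordered by its derivatives.\<close>

definition zcoeff :: "'n::finite weyl_coeffs \<Rightarrow> 'n multi_index \<Rightarrow> ('n \<Rightarrow> complex) \<Rightarrow> complex" where
  "zcoeff a \<beta> z = (\<Sum>\<gamma> | \<gamma> \<in> keys a \<and> snd \<gamma> = \<beta>. lookup a \<gamma> * mpow z (fst \<gamma>))"

lemma sum_zcoeff:
  "(\<Sum>\<gamma>\<in>keys a. lookup a \<gamma> * mpow z (fst \<gamma>) * h (snd \<gamma>)) = (\<Sum>\<beta>\<in>snd ` keys a. zcoeff a \<beta> z * h \<beta>)"
proof -
  have "(\<Sum>\<gamma>\<in>keys a. lookup a \<gamma> * mpow z (fst \<gamma>) * h (snd \<gamma>)) =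
      (\<Sum>\<beta>\<in>snd ` keys a. \<Sum>\<gamma> | \<gamma> \<in> keys a \<and> snd \<gamma> = \<beta>. lookup a \<gamma> * mpow z (fst \<gamma>) * h (snd \<gamma>))"
    by (rule sum.group [symmetric]) auto
  also have "\<dots> = (\<Sum>\<beta>\<in>snd ` keys a. zcoeff a \<beta> z * h \<beta>)"
    unfolding zcoeff_def by (intro sum.cong refl) (auto simp: sum_distrib_right)
  finally show ?thesis .
qed

lemma opfun_zcoeff: "opfun a is f z = (\<Sum>\<beta>\<in>snd ` keys a. zcoeff a \<beta> z * pds is (lookup \<beta>) f z)"
  unfolding opfun_def by (rule sum_zcoeff)

lemma ex_zcoeff_nonzero:
  assumes "weyl_op a \<noteq> (\<lambda>p. 0)"
  obtains z \<beta> where "z \<in> uhp" "\<beta> \<in> snd ` keys a" "zcoeff a \<beta> z \<noteq> 0"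
proof -
  obtain "is" :: "'a list" where dist: "distinct is" "set is = UNIV"
    using finite_distinct_list [of "UNIV :: 'a set"] by auto
  from assms obtain p where "weyl_op a p \<noteq> 0" by auto
  then obtain z where z: "z \<in> uhp" "meval (weyl_op a p) z \<noteq> 0"
    by (rule ex_nonzero_uhp)
  then have "(\<Sum>\<beta>\<in>snd ` keys a. zcoeff a \<beta> z * pds is (lookup \<beta>) (meval p) z) \<noteq> 0"
    using meval_weyl_op [OF dist, of a p z] by (simp add: opfun_zcoeff)
  then obtain \<beta> where "\<beta> \<in> snd ` keys a" "zcoeff a \<beta> z * pds is (lookup \<beta>) (meval p) z \<noteq> 0"
    by (rule sum.not_neutral_contains_not_neutral)
  then show thesis using z that by auto
qed

section \<open>Prescribed multiplicities and separation of two points\<close>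

lemma pderiv_linear_power_mult:
  fixes a :: complex
  shows "pderiv ([:- a, 1:] ^ Suc n * q) = [:- a, 1:] ^ n * (smult (of_nat (Suc n)) q + [:- a, 1:] * pderiv q)"
  by (simp add: pderiv_mult pderiv_power_Suc pderiv_pCons algebra_simps del: power_Suc)
    (simp add: algebra_simps)

lemma poly_pderiv_power_linear_less:
  fixes a :: complex
  assumes "k < n"
  shows "poly ((pderiv ^^ k) ([:- a, 1:] ^ n * q)) a = 0"
  using assms
proof (induction k arbitrary: n q)
  case (Suc k)
  then obtain n' where "n = Suc n'" "k < n'" by (cases n) auto
  then show ?case
    using Suc.IH by (simp only: funpow_Suc_right o_apply pderiv_linear_power_mult)
qed simp

lemma poly_pderiv_power_linear_eq:
  fixes a :: complex
  shows "poly ((pderiv ^^ n) ([:- a, 1:] ^ n * q)) a = fact n * poly q a"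
proof (induction n arbitrary: q)
  case (Suc n)
  show ?case
    unfolding funpow_Suc_right o_apply pderiv_linear_power_mult Suc.IH
    by (simp add: algebra_simps)
qed simp

text \<open>At \<open>z0\<close> the roots have higher multiplicity than any derivative in the
  operator can remove. At \<open>z1\<close> the multiplicities are a \<beta> of maximal total order
  among those with nonzero coefficient there: every other such index is smaller in some component,
  so only one term survives.\<close>

lemma ex_separating_prodfun:
  assumes a: "weyl_op a \<noteq> (\<lambda>p. 0)" and dist: "distinct is" "set is = UNIV"
  obtains z0 z1 b N where "z0 \<in> uhp" "z1 \<in> uhp"
    "opfun a is (prodfun (\<lambda>i. [:- z1 i, 1:] ^ b i * [:- z0 i, 1:] ^ N)) z0 = 0"
    "opfun a is (prodfun (\<lambda>i. [:- z1 i, 1:] ^ b i * [:- z0 i, 1:] ^ N)) z1 \<noteq> 0"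
proof -
  obtain z1 \<beta>1 where z1: "z1 \<in> uhp" and \<beta>1: "\<beta>1 \<in> snd ` keys a" "zcoeff a \<beta>1 z1 \<noteq> 0"
    using ex_zcoeff_nonzero [OF a] by blast
  define size :: "'a multi_index \<Rightarrow> nat" where "size \<beta> = (\<Sum>i\<in>UNIV. lookup \<beta> i)" for \<beta>
  define B where "B = {\<beta> \<in> snd ` keys a. zcoeff a \<beta> z1 \<noteq> 0}"
  have "finite B" "B \<noteq> {}" using \<beta>1 by (auto simp: B_def)
  then obtain \<beta>0 where \<beta>0: "\<beta>0 \<in> B" "\<And>\<beta>. \<beta> \<in> B \<Longrightarrow> size \<beta> \<le> size \<beta>0"
    using obtains_MAX [of B size] Max_ge [of "size ` B"] by (metis finite_imageI imageI)
  \<comment> \<open>It differs from \<open>z1\<close> in every coordinate, so the factors with roots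
    at \<open>z0\<close> do not vanish at \<open>z1\<close>.\<close>
  define z0 where "z0 i = z1 i + 1" for i
  have z0: "z0 \<in> uhp" using z1 by (auto simp: z0_def uhp_def)
  define N where "N = Suc (Max ((\<lambda>(\<beta>, i). lookup \<beta> i) ` (snd ` keys a \<times> UNIV)))"
  have N: "lookup \<beta> i < N" if "\<beta> \<in> snd ` keys a" for \<beta> i
    unfolding N_def less_Suc_eq_le by (rule Max_ge) (use that in force)+
  define g where "g i = [:- z1 i, 1:] ^ lookup \<beta>0 i * [:- z0 i, 1:] ^ N" for i
  have pds_g: "pds is (lookup \<beta>) (prodfun g) z = (\<Prod>i\<in>UNIV. poly ((pderiv ^^ lookup \<beta> i) (g i)) (z i))" for \<beta> z
    by (simp add: pds_prodfun dist) (simp add: prodfun_def)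
  have "poly ((pderiv ^^ k) (g i)) (z0 i) = 0" if "k < N" for k i
    using poly_pderiv_power_linear_less [OF that, of "z0 i" "[:- z1 i, 1:] ^ lookup \<beta>0 i"]
    by (simp add: g_def mult.commute)
  then have 0: "opfun a is (prodfun g) z0 = 0"
    using N by (auto simp: opfun_zcoeff pds_g intro!: sum.neutral)
  have "zcoeff a \<beta> z1 * pds is (lookup \<beta>) (prodfun g) z1 = 0" if "\<beta> \<in> snd ` keys a - {\<beta>0}" for \<beta>
  proof (cases "\<beta> \<in> B")
    case True
    have "\<exists>i. lookup \<beta> i < lookup \<beta>0 i"
    proof (rule ccontr)
      assume "\<not> ?thesis"
      then have le: "lookup \<beta>0 i \<le> lookup \<beta> i" for i by (simp add: not_less)
      from that have "lookup \<beta>0 \<noteq> lookup \<beta>" by auto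
      then obtain i where "lookup \<beta>0 i \<noteq> lookup \<beta> i" by blast
      with le [of i] have "lookup \<beta>0 i < lookup \<beta> i" by simp
      then have "size \<beta>0 < size \<beta>"
        unfolding size_def by (intro sum_strict_mono_ex1) (use le in auto)
      with \<beta>0(2) [OF True] show False by simp
    qed
    then obtain i where "lookup \<beta> i < lookup \<beta>0 i" ..
    then have "poly ((pderiv ^^ lookup \<beta> i) (g i)) (z1 i) = 0"
      unfolding g_def by (rule poly_pderiv_power_linear_less)
    then show ?thesis by (auto simp: pds_g)
  qed (use that in \<open>simp add: B_def\<close>)
  then have "(\<Sum>\<beta>\<in>snd ` keys a - {\<beta>0}. zcoeff a \<beta> z1 * pds is (lookup \<beta>) (prodfun g) z1) = 0"
    by (intro sum.neutral ballI)
  then have "opfun a is (prodfun g) z1 = zcoeff a \<beta>0 z1 * pds is (lookup \<beta>0) (prodfun g) z1"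
    using \<beta>0(1) unfolding opfun_zcoeff
    by (subst sum.remove [of _ \<beta>0]) (auto simp: B_def)
  also have "\<dots> \<noteq> 0"
    using \<beta>0(1) by (simp add: pds_g B_def) (simp add: g_def poly_pderiv_power_linear_eq z0_def)
  finally show thesis
    using that [OF z0 z1, of "lookup \<beta>0" N] 0 by (simp add: g_def [abs_def])
qed

text \<open>The root \<open>1 / b\<close> lies in the open lower half-plane, so the upper half-plane
  keeps a positive distance from it.\<close>

lemma norm_one_minus_mult_ge:
  assumes "Im b > 0"
  obtains c where "c > 0" "\<And>t. Im t > 0 \<Longrightarrow> c * (1 + norm t) \<le> norm (1 - b * t)"
proof -
  have "b \<noteq> 0" using assms by auto
  define r d where "r = 1 / b" and "d = - Im r"
  have d: "d > 0"
    using Im_inverse_diff_neg [of b 0] assms by (simp add: d_def r_def)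
  \<comment> \<open>Chosen to fit the estimate
    \<open>d (1 + |t|) \<le> (1 + |r| + d) |t - r|\<close>.\<close>
  define c where "c = norm b * (d / (1 + norm r + d))"
  have "c > 0" using d \<open>b \<noteq> 0\<close> by (simp add: c_def add_pos_nonneg add_nonneg_pos)
  moreover have "c * (1 + norm t) \<le> norm (1 - b * t)" if "Im t > 0" for t
  proof -
    have "d \<le> Im (t - r)" using that by (simp add: d_def)
    then have 1: "d \<le> norm (t - r)" using abs_Im_le_cmod [of "t - r"] by linarith
    have 2: "norm t \<le> norm r + norm (t - r)" using norm_triangle_sub [of t r] by simp
    have "d * (1 + norm t) \<le> d * (1 + norm r) + d * norm (t - r)"
      using 2 d by (simp add: distrib_left [symmetric])
    also have "\<dots> \<le> norm (t - r) * (1 + norm r) + d * norm (t - r)"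
      using 1 by (intro add_mono mult_right_mono) auto
    finally have "d / (1 + norm r + d) * (1 + norm t) \<le> norm (t - r)"
      using d by (simp add: field_simps add_pos_nonneg)
    then have "c * (1 + norm t) \<le> norm b * norm (t - r)"
      unfolding c_def mult.assoc by (intro mult_left_mono) auto
    also have "\<dots> = norm (1 - b * t)"
      using \<open>b \<noteq> 0\<close> norm_minus_commute [of "b * t" 1]
      by (simp add: norm_mult [symmetric] r_def algebra_simps)
    finally show ?thesis .
  qed
  ultimately show thesis by (rule that)
qed

section \<open>Growth bounds and small perturbations\<close>

lemma norm_linear_power_mult_le:
  fixes a b t :: complex
  assumes "n + k \<le> m"
  shows "norm (poly ([:- a, 1:] ^ n * [:- b, 1:] ^ k) t) \<le>
    (1 + norm a) ^ n * (1 + norm b) ^ k * (1 + norm t) ^ m"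
proof -
  have lin: "norm (t - a) \<le> (1 + norm a) * (1 + norm t)" for a
  proof -
    have "(1 + norm a) * (1 + norm t) = 1 + (norm t + norm a) + norm a * norm t"
      by (simp add: algebra_simps)
    moreover have "0 \<le> norm a * norm t" by simp
    ultimately show ?thesis
      using norm_triangle_ineq4 [of t a] by linarith
  qed
  have "norm (poly ([:- a, 1:] ^ n * [:- b, 1:] ^ k) t) = norm (t - a) ^ n * norm (t - b) ^ k"
    by (simp add: norm_mult norm_power)
  also have "\<dots> \<le> ((1 + norm a) * (1 + norm t)) ^ n * ((1 + norm b) * (1 + norm t)) ^ k"
    by (intro mult_mono power_mono lin) auto
  also have "\<dots> = (1 + norm a) ^ n * (1 + norm b) ^ k * (1 + norm t) ^ (n + k)"
    by (simp add: power_mult_distrib power_add mult_ac)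
  also have "\<dots> \<le> (1 + norm a) ^ n * (1 + norm b) ^ k * (1 + norm t) ^ m"
    using assms by (intro mult_left_mono power_increasing) auto
  finally show ?thesis .
qed

text \<open>Both products are compared with \<open>\<Prod>_i (1 + |z_i|)^m\<close>: the stable one
  from below, as its roots avoid the closed upper half-plane, the other from above, as its degree in
  each variable is at most \<open>m\<close>.\<close>

lemma ex_small_perturbation:
  fixes w z0 z1 :: "'n::finite \<Rightarrow> complex"
  assumes w: "w \<in> uhp" and m: "\<And>i. b i + N \<le> m" "m \<ge> 1"
  obtains e :: real where "e > 0"
    "\<And>z. z \<in> uhp \<Longrightarrow> e * norm (prodfun (\<lambda>i. [:- z1 i, 1:] ^ b i * [:- z0 i, 1:] ^ N) z) <
      norm (prodfun (\<lambda>i. [:1, - w i / of_nat m:] ^ m) z)"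
proof -
  have "\<exists>c>0. \<forall>t. Im t > 0 \<longrightarrow> c * (1 + norm t) \<le> norm (1 - w i / of_nat m * t)" for i
  proof -
    have "Im (w i / of_nat m) > 0" using w m(2) by (simp add: uhp_def)
    then show ?thesis by (rule norm_one_minus_mult_ge) blast
  qed
  then obtain c where c: "\<And>i. c i > 0"
      "\<And>i t. Im t > 0 \<Longrightarrow> c i * (1 + norm t) \<le> norm (1 - w i / of_nat m * t)"
    by metis
  define cc where "cc = (\<Prod>i\<in>UNIV. c i ^ m)"
  define D where "D = (\<Prod>i\<in>UNIV. (1 + norm (z1 i)) ^ b i * (1 + norm (z0 i)) ^ N)"
  define W where "W z = (\<Prod>i\<in>UNIV. (1 + norm (z i)) ^ m)" for z :: "'n \<Rightarrow> complex"
  have pos: "cc > 0" "D \<ge> 0" "W z > 0" for z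
    using c(1) by (auto simp: cc_def D_def W_def add_pos_nonneg intro!: prod_pos prod_nonneg zero_less_power)
  have up: "norm (prodfun (\<lambda>i. [:- z1 i, 1:] ^ b i * [:- z0 i, 1:] ^ N) z) \<le> D * W z" for z
    unfolding prodfun_def D_def W_def prod_norm [symmetric] prod.distrib [symmetric]
    by (intro prod_mono conjI norm_ge_zero norm_linear_power_mult_le m)
  have low: "cc * W z \<le> norm (prodfun (\<lambda>i. [:1, - w i / of_nat m:] ^ m) z)" if z: "z \<in> uhp" for z
  proof -
    have "cc * W z = (\<Prod>i\<in>UNIV. (c i * (1 + norm (z i))) ^ m)"
      by (simp add: cc_def W_def prod.distrib power_mult_distrib)
    also have "\<dots> \<le> (\<Prod>i\<in>UNIV. norm (1 - w i / of_nat m * z i) ^ m)"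
      using z c(1) by (intro prod_mono conjI power_mono c zero_le_power mult_nonneg_nonneg)
        (auto simp: uhp_def less_imp_le)
    also have "\<dots> = norm (prodfun (\<lambda>i. [:1, - w i / of_nat m:] ^ m) z)"
      by (simp add: prodfun_def prod_norm [symmetric] norm_power mult.commute)
    finally show ?thesis .
  qed
  show thesis
  \<comment> \<open>With \<open>D + 1\<close> instead of \<open>D\<close> the denominator is
    positive and the final inequality strict.\<close>
  proof (rule that [of "cc / (D + 1)"])
    show "cc / (D + 1) > 0" using pos by (simp add: add_nonneg_pos)
    fix z :: "'n \<Rightarrow> complex"
    assume z: "z \<in> uhp"
    have "cc / (D + 1) * norm (prodfun (\<lambda>i. [:- z1 i, 1:] ^ b i * [:- z0 i, 1:] ^ N) z) \<le>
        cc / (D + 1) * (D * W z)"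
      using pos up by (intro mult_left_mono) auto
    also have "\<dots> = (cc * W z) * (D / (D + 1))" by simp
    also have "\<dots> < (cc * W z) * 1"
      using pos pos(3) [of z] by (intro mult_strict_left_mono) auto
    also have "\<dots> \<le> norm (prodfun (\<lambda>i. [:1, - w i / of_nat m:] ^ m) z)"
      using low [OF z] by simp
    finally show "cc / (D + 1) * norm (prodfun (\<lambda>i. [:- z1 i, 1:] ^ b i * [:- z0 i, 1:] ^ N) z) <
        norm (prodfun (\<lambda>i. [:1, - w i / of_nat m:] ^ m) z)" .
  qed
qed

section \<open>Nonvanishing on approximate exponentials\<close>

lemma stable_iff_uhp: "stable p \<longleftrightarrow> (\<forall>x\<in>uhp. meval p x \<noteq> 0)"
  by (auto simp: stable_def uhp_def)

text \<open>If \<open>T\<close> annihilated \<open>f = (1 - z w/m)\<^sup>m\<close>, it would map the stable polynomial \<open>f + e g\<close> to \<open>e T g\<close>, which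
  vanishes at \<open>z0\<close> but not at \<open>z1\<close>.\<close>

lemma preserver_exp_approx_nonzero:
  assumes pres: "weyl_op a \<in> stability_preservers" and dist: "distinct is" "set is = UNIV"
  obtains M where "\<And>m w z. m \<ge> M \<Longrightarrow> w \<in> uhp \<Longrightarrow> z \<in> uhp \<Longrightarrow>
    opfun a is (prodfun (\<lambda>i. [:1, - w i / of_nat m:] ^ m)) z \<noteq> 0"
proof -
  have nz: "weyl_op a \<noteq> (\<lambda>p. 0)"
    and pres: "\<And>p. stable p \<Longrightarrow> weyl_op a p \<noteq> 0 \<Longrightarrow> stable (weyl_op a p)"
    using pres by (auto simp: stability_preservers_def stable_polys_def image_subset_iff)
  obtain z0 z1 b N where sep: "z0 \<in> uhp" "z1 \<in> uhp"
    "opfun a is (prodfun (\<lambda>i. [:- z1 i, 1:] ^ b i * [:- z0 i, 1:] ^ N)) z0 = 0"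
    "opfun a is (prodfun (\<lambda>i. [:- z1 i, 1:] ^ b i * [:- z0 i, 1:] ^ N)) z1 \<noteq> 0"
    using ex_separating_prodfun [OF nz dist] by blast
  define g where "g = prodfun (\<lambda>i. [:- z1 i, 1:] ^ b i * [:- z0 i, 1:] ^ N)"
  \<comment> \<open>From here on \<open>m\<close> is positive and bounds the degree of
    \<open>g\<close> in each variable, as the perturbation argument requires.\<close>
  define M where "M = Suc (Max (range b) + N)"
  have "opfun a is (prodfun (\<lambda>i. [:1, - w i / of_nat m:] ^ m)) z \<noteq> 0"
    if m: "m \<ge> M" and w: "w \<in> uhp" and z: "z \<in> uhp" for m w z
  proof -
    define f where "f = prodfun (\<lambda>i. [:1, - w i / of_nat m:] ^ m)"
    have "b i \<le> Max (range b)" for i by (rule Max_ge) auto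
    then have bN: "b i + N \<le> m" for i
      using m by (metis M_def Suc_leD add_le_mono1 order_trans)
    have m1: "m \<ge> 1" using m by (simp add: M_def)
    obtain e where e: "e > 0" "\<And>z. z \<in> uhp \<Longrightarrow> e * norm (g z) < norm (f z)"
      using ex_small_perturbation [where b = b and N = N and m = m and w = w, OF w bN m1]
      unfolding g_def f_def by blast
    have f_nz: "f z \<noteq> 0" "f z + of_real e * g z \<noteq> 0" if "z \<in> uhp" for z
    proof -
      have "norm (f z) > norm (of_real e * g z)"
        using e that by (simp add: norm_mult)
      then show "f z \<noteq> 0" "f z + of_real e * g z \<noteq> 0"
        by (auto simp: add_eq_0_iff2)
    qed
    have poly: "polyfun f" "polyfun g"
      by (simp_all add: f_def g_def polyfun_prodfun)
    obtain p where p: "meval p = f"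
      using polyfun_eq_meval [OF poly(1)] by blast
    obtain h where h: "meval h = (\<lambda>x. f x + of_real e * g x)"
      using polyfun_eq_meval [OF polyfun.add [OF poly(1) polyfun.mult [OF polyfun.const poly(2)]]] by blast
    have op_h: "meval (weyl_op a h) x = opfun a is f x + of_real e * opfun a is g x" for x
      by (simp add: meval_weyl_op [OF dist] h opfun_add_cmult poly)
    have "weyl_op a p \<noteq> 0"
    proof
      assume "weyl_op a p = 0"
      then have "opfun a is f x = 0" for x
        using meval_weyl_op [OF dist, of a p x] by (simp add: p)
      then have "meval (weyl_op a h) z0 = 0" "meval (weyl_op a h) z1 \<noteq> 0"
        using op_h sep e by (simp_all add: g_def)
      moreover from this have "weyl_op a h \<noteq> 0" by auto
      moreover have "stable h"
        using f_nz by (simp add: stable_iff_uhp h)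
      ultimately show False
        using pres [of h] sep(1) by (auto simp: stable_iff_uhp)
    qed
    moreover have "stable p"
      using f_nz by (simp add: stable_iff_uhp p)
    ultimately have "meval (weyl_op a p) z \<noteq> 0"
      using pres [of p] z by (auto simp: stable_iff_uhp)
    then show ?thesis
      by (simp add: meval_weyl_op [OF dist] p f_def)
  qed
  then show thesis by (rule that)
qed

section \<open>From approximate exponentials to the symbol\<close>

lemma pderiv_power_linear:
  fixes b :: complex
  assumes "k \<le> m"
  shows "(pderiv ^^ k) ([:1, b:] ^ m) = smult ((\<Prod>i<k. of_nat m - of_nat i) * b ^ k) ([:1, b:] ^ (m - k))"
  using assms
proof (induction k)
  case (Suc k)
  then obtain l where l: "m - k = Suc l" by (cases "m - k") auto
  with Suc.prems have l': "m - Suc k = l" "of_nat m - of_nat k = (of_nat (Suc l) :: complex)"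
    by (auto simp: of_nat_diff [symmetric])
  have "(pderiv ^^ Suc k) ([:1, b:] ^ m) =
      smult ((\<Prod>i<k. of_nat m - of_nat i) * b ^ k) (pderiv ([:1, b:] ^ Suc l))"
    using Suc l by (simp add: pderiv_smult del: power_Suc)
  also have "pderiv ([:1, b:] ^ Suc l) = smult (of_nat (Suc l) * b) ([:1, b:] ^ l)"
    by (simp only: pderiv_power_Suc) (simp add: pderiv_pCons mult.commute)
  finally show ?case
    unfolding l'(1) l'(2) [symmetric] by (simp add: mult_ac)
qed simp

text \<open>Applied to \<open>\<Prod>_i (1 - z_i w_i / m)^m\<close>, the operator gives
  \<open>\<Prod>_i (1 - z_i w_i / m)^(m - N)\<close> times a polynomial that converges to
  \<open>F(z, -w)\<close> as \<open>m\<close> grows.\<close>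

lemma preserver_imp_symbol_nonzero:
  fixes a :: "'n::finite weyl_coeffs" and x :: "'n + 'n \<Rightarrow> complex"
  assumes pres: "weyl_op a \<in> stability_preservers" and x: "x \<in> uhp"
  shows "meval (negate_w (symbol (weyl_op a))) x \<noteq> 0"
proof -
  have nz: "weyl_op a \<noteq> (\<lambda>p. 0)"
    using pres by (simp add: stability_preservers_def)
  obtain "is" :: "'n list" where dist: "distinct is" "set is = UNIV"
    using finite_distinct_list [of "UNIV :: 'n set"] by auto
  obtain M where M: "\<And>m w z. m \<ge> M \<Longrightarrow> w \<in> uhp \<Longrightarrow> z \<in> uhp \<Longrightarrow>
      opfun a is (prodfun (\<lambda>i. [:1, - w i / of_nat m:] ^ m)) z \<noteq> 0"
    using preserver_exp_approx_nonzero [OF pres dist] by blast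
  define N where "N = Max ((\<lambda>(\<gamma>, i). lookup (snd \<gamma>) i) ` (keys a \<times> UNIV))"
  have N: "lookup (snd \<gamma>) i \<le> N" if "\<gamma> \<in> keys a" for \<gamma> i
    unfolding N_def by (rule Max_ge) (use that in force)+
  \<comment> \<open>The cofactor with \<open>1/m\<close> replaced by \<open>e\<close>. Since
    \<open>N\<close> bounds all orders of differentiation, the remaining exponents
    \<open>N - k\<close> are nonnegative and do not depend on \<open>m\<close>.\<close>
  define G where "G e x = (\<Sum>\<gamma>\<in>keys a. lookup a \<gamma> * mpow (\<lambda>i. x (Inl i)) (fst \<gamma>) *
      mpow (\<lambda>i. - x (Inr i)) (snd \<gamma>) *
      (\<Prod>i\<in>UNIV. falling_ratio e (lookup (snd \<gamma>) i) * (1 - of_real e * (x (Inr i) * x (Inl i))) ^ (N - lookup (snd \<gamma>) i)))"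
    for e and x :: "'n + 'n \<Rightarrow> complex"
  have G_0: "G 0 x = meval (negate_w (symbol (weyl_op a))) x" for x
    by (simp add: G_def meval_negate_symbol)
  have G_nz: "G (1 / real m) x \<noteq> 0" if m: "m \<ge> max (max M N) 1" and x: "x \<in> uhp" for m x
  proof -
    define z w where "z = (\<lambda>i. x (Inl i))" and "w = (\<lambda>i. x (Inr i))"
    define u where "u i = 1 - of_real (1 / real m) * (w i * z i)" for i
    have m0: "of_nat m \<noteq> (0 :: complex)" using m by simp
    have poly: "poly ((pderiv ^^ k) ([:1, - w i / of_nat m:] ^ m)) (z i) =
        u i ^ (m - N) * ((- w i) ^ k * (falling_ratio (1 / real m) k * u i ^ (N - k)))" if "k \<le> N" for k i
    proof -
      have "poly ((pderiv ^^ k) ([:1, - w i / of_nat m:] ^ m)) (z i) =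
          of_nat m ^ k * falling_ratio (1 / real m) k * (- w i / of_nat m) ^ k * u i ^ (m - k)"
        using that m by (simp add: pderiv_power_linear prod_diff_eq_ff u_def mult.commute)
      also have "of_nat m ^ k * falling_ratio (1 / real m) k * (- w i / of_nat m) ^ k = falling_ratio (1 / real m) k * (- w i) ^ k"
        using m0 by (simp only: power_divide) simp
      also have "m - k = (m - N) + (N - k)" using that m by auto
      finally show ?thesis by (simp add: power_add)
    qed
    have "opfun a is (prodfun (\<lambda>i. [:1, - w i / of_nat m:] ^ m)) z =
        (\<Sum>\<gamma>\<in>keys a. lookup a \<gamma> * mpow z (fst \<gamma>) *
          (\<Prod>i\<in>UNIV. poly ((pderiv ^^ lookup (snd \<gamma>) i) ([:1, - w i / of_nat m:] ^ m)) (z i)))"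
      by (simp add: opfun_def pds_prodfun dist) (simp add: prodfun_def)
    also have "\<dots> = (\<Sum>\<gamma>\<in>keys a. lookup a \<gamma> * mpow z (fst \<gamma>) *
          ((\<Prod>i\<in>UNIV. u i ^ (m - N)) * (mpow (\<lambda>i. - w i) (snd \<gamma>) *
          (\<Prod>i\<in>UNIV. falling_ratio (1 / real m) (lookup (snd \<gamma>) i) * u i ^ (N - lookup (snd \<gamma>) i)))))"
    proof (rule sum.cong [OF refl])
      fix \<gamma>
      assume "\<gamma> \<in> keys a"
      then show "lookup a \<gamma> * mpow z (fst \<gamma>) *
          (\<Prod>i\<in>UNIV. poly ((pderiv ^^ lookup (snd \<gamma>) i) ([:1, - w i / of_nat m:] ^ m)) (z i)) =
          lookup a \<gamma> * mpow z (fst \<gamma>) *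
          ((\<Prod>i\<in>UNIV. u i ^ (m - N)) * (mpow (\<lambda>i. - w i) (snd \<gamma>) *
          (\<Prod>i\<in>UNIV. falling_ratio (1 / real m) (lookup (snd \<gamma>) i) * u i ^ (N - lookup (snd \<gamma>) i))))"
        using N by (simp only: poly mpow_def prod.distrib)
    qed
    also have "\<dots> = (\<Prod>i\<in>UNIV. u i ^ (m - N)) * G (1 / real m) x"
      unfolding G_def sum_distrib_left
      by (rule sum.cong) (simp_all add: z_def w_def u_def ac_simps)
    finally show ?thesis
      using M [of m w z] m x by (auto simp: uhp_def z_def w_def)
  qed
  have poly_mpow: "polyfun (\<lambda>x. mpow (\<lambda>i. \<sigma> i x) \<alpha>)" if "\<And>i. polyfun (\<sigma> i)"
    for \<sigma> :: "'n \<Rightarrow> ('n + 'n \<Rightarrow> complex) \<Rightarrow> complex" and \<alpha>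
    using that by (rule polyfun_mpow)
  have G_poly: "polyfun (G e)" for e
    unfolding G_def [abs_def]
    by (intro polyfun_sum polyfun_prod polyfun.mult polyfun_power polyfun_diff polyfun.const poly_mpow
        polyfun_uminus polyfun.coord)
  have G_cont: "continuous_on UNIV (\<lambda>(e, t). G e (\<lambda>i. x i + t * (y i - x i)))" for x y
    unfolding G_def case_prod_beta mpow_def falling_ratio_def by (intro continuous_intros)
  \<comment> \<open>Hurwitz's theorem requires one point of \<open>uhp\<close> where
    \<open>F(z, -w)\<close> is nonzero: \<open>z\<close> is fixed so that some coefficient survives,
    which leaves a nonzero polynomial \<open>p\<close> in \<open>w\<close>.\<close>
  obtain z \<beta> where z: "z \<in> uhp" "\<beta> \<in> snd ` keys a" "zcoeff a \<beta> z \<noteq> 0"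
    using ex_zcoeff_nonzero [OF nz] by blast
  define s :: "'n multi_index \<Rightarrow> complex" where "s \<beta> = (\<Prod>i\<in>UNIV. (- 1) ^ lookup \<beta> i)" for \<beta>
  define p where "p = (\<Sum>\<beta>\<in>snd ` keys a. single \<beta> (zcoeff a \<beta> z * s \<beta>))"
  have "lookup p \<beta> = zcoeff a \<beta> z * s \<beta>"
    using z(2) by (simp add: p_def lookup_sum lookup_single when_def)
  then have "lookup p \<beta> \<noteq> 0"
    using z(3) by (simp add: s_def)
  then have "p \<noteq> 0" by auto
  then obtain w where w: "w \<in> uhp" "meval p w \<noteq> 0"
    by (rule ex_nonzero_uhp)
  have "meval p w = (\<Sum>\<beta>\<in>snd ` keys a. zcoeff a \<beta> z * mpow (\<lambda>i. - w i) \<beta>)"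
    by (simp add: p_def meval_sum meval_single mpow_uminus s_def mult.assoc)
  also have "\<dots> = G 0 (case_sum z w)"
    unfolding G_0 meval_negate_symbol using sum_zcoeff [of a z "\<lambda>\<beta>. mpow (\<lambda>i. - w i) \<beta>"] by simp
  finally have "G 0 (case_sum z w) \<noteq> 0" using w(2) by simp
  moreover have "case_sum z w \<in> uhp"
    using z(1) w(1) by (auto simp: uhp_def split: sum.split)
  ultimately have "G 0 x \<noteq> 0"
    using hurwitz_uhp [OF G_cont G_poly G_nz _ _ x] by blast
  then show ?thesis by (simp add: G_0)
qed

theorem theorem1p2:
  fixes T :: "'n::finite mpoly \<Rightarrow> 'n mpoly"
  assumes "T \<in> weyl_algebra"
  shows "T \<in> stability_preservers \<longleftrightarrow> negate_w (symbol T) \<in> stable_polys"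
proof -
  obtain a where T: "T = weyl_op a"
    using assms by (auto simp: weyl_algebra_def)
  obtain "is" :: "'n list" where dist: "distinct is" "set is = UNIV"
    using finite_distinct_list [of "UNIV :: 'n set"] by auto
  show ?thesis
  proof
    assume "T \<in> stability_preservers"
    then show "negate_w (symbol T) \<in> stable_polys"
      using preserver_imp_symbol_nonzero [of a] by (simp add: T stable_polys_def stable_iff_uhp)
  next
    assume "negate_w (symbol T) \<in> stable_polys"
    then have F: "meval (negate_w (symbol T)) x \<noteq> 0" if "x \<in> uhp" for x
      using that by (simp add: stable_polys_def stable_iff_uhp)
    have S: "(\<Sum>\<gamma>\<in>keys a. lookup a \<gamma> * mpow z (fst \<gamma>) * mpow (\<lambda>i. - w i) (snd \<gamma>)) \<noteq> 0"
      if "z \<in> uhp" "w \<in> uhp" for z w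
    proof -
      have "case_sum z w \<in> uhp"
        using that by (auto simp: uhp_def split: sum.split)
      from F [OF this] show ?thesis by (simp add: T meval_negate_symbol)
    qed
    \<comment> \<open>By uniqueness of the coefficients the zero operator has symbol 0, which is not
      stable.\<close>
    have "T \<noteq> (\<lambda>p. 0)"
    proof
      assume "T = (\<lambda>p. 0)"
      also have "\<dots> = weyl_op 0" by (simp add: weyl_op_def fun_eq_iff)
      finally have "a = 0" using injD [OF inj_weyl_op] by (simp add: T)
      moreover have "(\<lambda>_. \<i>) \<in> uhp" by (simp add: uhp_def)
      ultimately show False using S by auto
    qed
    moreover have "stable (T f)" if f: "stable f" and nz: "T f \<noteq> 0" for f
    proof -
      obtain y where y: "y \<in> uhp" "meval (T f) y \<noteq> 0"
        using ex_nonzero_uhp [OF nz] by blast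
      have f_nz: "meval f z \<noteq> 0" if "z \<in> uhp" for z
        using f that by (simp add: stable_iff_uhp)
      have T_f: "meval (T f) x = (\<Sum>\<gamma>\<in>keys a. lookup a \<gamma> * mpow x (fst \<gamma>) *
          (\<Prod>i\<in>UNIV. falling_ratio 0 (lookup (snd \<gamma>) i)) * pds is (lookup (snd \<gamma>)) (meval f) x)" for x
        by (simp add: T meval_weyl_op [OF dist] opfun_def)
      have "meval (T f) x \<noteq> 0" if "x \<in> uhp" for x
        unfolding T_f
        by (rule symbol_nonzero_imp_op_nonzero [OF dist S polyfun_meval f_nz y(1) _ that])
          (use y(2) in \<open>simp_all add: T_f\<close>)
      then show ?thesis by (simp add: stable_iff_uhp)
    qed
    ultimately show "T \<in> stability_preservers"
      using assms by (auto simp: stability_preservers_def stable_polys_def)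
  qed
qed

end
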